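(* Let $K$ be an infinite stable field of finite weight. Then for all but finitely many primes $q$, $K^q=K$, where $K^q=\{x^q: x\in K\}$. More precisely, if $w(K)=w<\omega$, then there are at most $w$ many primes $q$ for which $K^q\neq K$.
   Context: A stable field is a field $K$ considered as a first-order structure, endowed with its field operations and possibly additional relations, such that $\mathrm{Th}(K)$ is stable. By convention $K$ is a monster model (very saturated model) of its theory, and sets of parameters are small, i.e. of cardinality less than the degree of saturation. All complete types are finitary. Generics: a definable subset $X$ of a stable group $G$ is generic if finitely many translates of $X$ cover $G$; a complete type over a set $A$ is generic if every formula in it defines a generic set. An infinite stable field has a unique generic type (over each set of parameters), which is the generic type both of the additive and of the multiplicative group. Weight: in a stable theory with monster model $\mathfrak{C}$, for $A\subseteq \mathfrak{C}$ and $p\in S(A)$, the weight of $p$ is the supremum of the cardinalities $\kappa$ for which there exist a non-forking extension $q=\mathrm{tp}(a/B)\in S(B)$ of $p$ and a $B$-independent sequence $(b_i:i<\kappa)$ (of finite tuples) such that for every $i<\kappa$, $a$ is not independent (in the sense of forking) from $b_i$ over $A$. The weight $w(K)$ of a stable field $K$ is the weight of its generic type. *)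

theory Defs
  imports Complex_Main "HOL-Library.Extended_Nat" "HOL-Computational_Algebra.Primes"
begin

unbundle cardinal_syntax

section \<open>Fields with additional relations as first-order structures\<close>

datatype tm = Var nat | Zero | One | Minus tm | Plus tm tm | Times tm tm

text \<open>
  Symbols of type \<open>'r\<close> carry no arity: a symbol stands for one relation of each arity, and its
  interpretation is a predicate on lists. A symbol of fixed arity is one whose interpretation is
  empty on lists of any other length; the pure field is obtained by making all interpretations
  empty.
\<close>

datatype 'r fm =
    Eq tm tm
  | Rel 'r "tm list"
  | Neg "'r fm"
  | Conj "'r fm" "'r fm"
  | Exists nat "'r fm"

primrec tm_vars :: "tm \<Rightarrow> nat set" where
  "tm_vars (Var i) = {i}"
| "tm_vars Zero = {}"
| "tm_vars One = {}"
| "tm_vars (Minus t) = tm_vars t"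
| "tm_vars (Plus s t) = tm_vars s \<union> tm_vars t"
| "tm_vars (Times s t) = tm_vars s \<union> tm_vars t"

primrec free_vars :: "'r fm \<Rightarrow> nat set" where
  "free_vars (Eq s t) = tm_vars s \<union> tm_vars t"
| "free_vars (Rel r ts) = (\<Union>t\<in>set ts. tm_vars t)"
| "free_vars (Neg \<phi>) = free_vars \<phi>"
| "free_vars (Conj \<phi> \<psi>) = free_vars \<phi> \<union> free_vars \<psi>"
| "free_vars (Exists i \<phi>) = free_vars \<phi> - {i}"

primrec tm_val :: "(nat \<Rightarrow> 'k::field) \<Rightarrow> tm \<Rightarrow> 'k" where
  "tm_val e (Var i) = e i"
| "tm_val e Zero = 0"
| "tm_val e One = 1"
| "tm_val e (Minus t) = - tm_val e t"
| "tm_val e (Plus s t) = tm_val e s + tm_val e t"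
| "tm_val e (Times s t) = tm_val e s * tm_val e t"

primrec sat :: "('r \<Rightarrow> 'k::field list \<Rightarrow> bool) \<Rightarrow> (nat \<Rightarrow> 'k) \<Rightarrow> 'r fm \<Rightarrow> bool" where
  "sat R e (Eq s t) \<longleftrightarrow> tm_val e s = tm_val e t"
| "sat R e (Rel r ts) \<longleftrightarrow> R r (map (tm_val e) ts)"
| "sat R e (Neg \<phi>) \<longleftrightarrow> \<not> sat R e \<phi>"
| "sat R e (Conj \<phi> \<psi>) \<longleftrightarrow> sat R e \<phi> \<and> sat R e \<psi>"
| "sat R e (Exists i \<phi>) \<longleftrightarrow> (\<exists>x. sat R (e(i := x)) \<phi>)"

text \<open>The value 0 beyond the end of the tuple is a dummy; it is only used for formulas whose free
  variables all lie below the length of the tuple.\<close>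

definition assign :: "'k::field list \<Rightarrow> nat \<Rightarrow> 'k" where
  "assign xs i = (if i < length xs then xs ! i else 0)"


section \<open>Formulas with parameters and types\<close>

text \<open>
  A pair \<open>(\<phi>, c)\<close> represents the formula \<open>\<phi>(x, c)\<close> with parameters \<open>c\<close>: if \<open>x\<close> has length \<open>n\<close>, then
  the variables of index less than \<open>n\<close> stand for \<open>x\<close> and the next ones for \<open>c\<close>.
\<close>

type_synonym ('r, 'k) pfm = "'r fm \<times> 'k list"

definition formulas_over :: "'k set \<Rightarrow> nat \<Rightarrow> ('r, 'k) pfm set" where
  "formulas_over A n = {(\<phi>, c). set c \<subseteq> A \<and> free_vars \<phi> \<subseteq> {..<n + length c}}"

definition holds :: "('r \<Rightarrow> 'k::field list \<Rightarrow> bool) \<Rightarrow> ('r, 'k) pfm \<Rightarrow> 'k list \<Rightarrow> bool" where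
  "holds R \<psi> a \<longleftrightarrow> sat R (assign (a @ snd \<psi>)) (fst \<psi>)"

definition tp :: "('r \<Rightarrow> 'k::field list \<Rightarrow> bool) \<Rightarrow> 'k list \<Rightarrow> 'k set \<Rightarrow> ('r, 'k) pfm set" where
  "tp R a A = {\<psi> \<in> formulas_over A (length a). holds R \<psi> a}"

definition complete_type ::
    "('r \<Rightarrow> 'k::field list \<Rightarrow> bool) \<Rightarrow> 'k set \<Rightarrow> nat \<Rightarrow> ('r, 'k) pfm set \<Rightarrow> bool" where
  "complete_type R A n p \<longleftrightarrow>
     p \<subseteq> formulas_over A n \<and>
     (\<forall>F\<subseteq>p. finite F \<longrightarrow> (\<exists>a. length a = n \<and> (\<forall>\<psi>\<in>F. holds R \<psi> a))) \<and>
     (\<forall>\<phi> c. (\<phi>, c) \<in> formulas_over A n \<longrightarrow> (\<phi>, c) \<in> p \<or> (Neg \<phi>, c) \<in> p)"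


section \<open>Monster models and stability\<close>

definition small :: "'i rel \<Rightarrow> 'k set \<Rightarrow> bool" where
  "small \<kappa> A \<longleftrightarrow> |A| <o \<kappa>"

text \<open>The degree of saturation \<open>\<kappa>\<close> is a cardinal greater than the number of formulas, hence
  uncountable.\<close>

definition monster :: "'i rel \<Rightarrow> ('r \<Rightarrow> 'k::field list \<Rightarrow> bool) \<Rightarrow> bool" where
  "monster \<kappa> R \<longleftrightarrow>
     Card_order \<kappa> \<and> |UNIV :: 'r fm set| <o \<kappa> \<and>
     (\<forall>A n p. small \<kappa> A \<and> complete_type R A n p \<longrightarrow>
        (\<exists>a. length a = n \<and> (\<forall>\<psi>\<in>p. holds R \<psi> a)))"

text \<open>No formula \<open>\<phi>(x; y)\<close> has the order property. By compactness, the order property in some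
  model of \<open>Th(K)\<close> amounts to the existence of half-graphs of every finite length in \<open>K\<close>.\<close>

definition stable_theory :: "('r \<Rightarrow> 'k::field list \<Rightarrow> bool) \<Rightarrow> bool" where
  "stable_theory R \<longleftrightarrow>
     (\<forall>\<phi> m n. free_vars \<phi> \<subseteq> {..<m + n} \<longrightarrow>
        (\<exists>N. \<not> (\<exists>a b :: nat \<Rightarrow> 'k list.
            (\<forall>i<N. length (a i) = m \<and> length (b i) = n) \<and>
            (\<forall>i<N. \<forall>j<N. sat R (assign (a i @ b j)) \<phi> \<longleftrightarrow> i < j))))"


section \<open>Forking and independence\<close>

text \<open>\<open>divides R n A \<psi>\<close>: the formula \<open>\<psi> = \<phi>(x, b)\<close>, where \<open>x\<close> has length \<open>n\<close>, divides over \<open>A\<close>.\<close>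

definition divides ::
    "('r \<Rightarrow> 'k::field list \<Rightarrow> bool) \<Rightarrow> nat \<Rightarrow> 'k set \<Rightarrow> ('r, 'k) pfm \<Rightarrow> bool" where
  "divides R n A \<psi> \<longleftrightarrow>
     (\<exists>(k::nat) (b :: nat \<Rightarrow> 'k list).
        (\<forall>i. length (b i) = length (snd \<psi>) \<and> tp R (b i) A = tp R (snd \<psi>) A) \<and>
        (\<forall>I. finite I \<and> card I = k \<longrightarrow>
           \<not> (\<exists>a. length a = n \<and> (\<forall>i\<in>I. holds R (fst \<psi>, b i) a))))"

text \<open>\<open>p\<close> implies a finite disjunction of formulas, with arbitrary parameters, dividing over \<open>A\<close>.\<close>

definition forks ::
    "('r \<Rightarrow> 'k::field list \<Rightarrow> bool) \<Rightarrow> nat \<Rightarrow> 'k set \<Rightarrow> ('r, 'k) pfm set \<Rightarrow> bool" where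
  "forks R n A p \<longleftrightarrow>
     (\<exists>D F. finite D \<and> D \<subseteq> formulas_over UNIV n \<and> (\<forall>\<psi>\<in>D. divides R n A \<psi>) \<and>
        finite F \<and> F \<subseteq> p \<and>
        (\<forall>a. length a = n \<and> (\<forall>\<psi>\<in>F. holds R \<psi> a) \<longrightarrow> (\<exists>\<psi>\<in>D. holds R \<psi> a)))"

text \<open>\<open>indep R a A B\<close>: \<open>a\<close> is independent from \<open>B\<close> over \<open>A\<close>.\<close>

definition indep ::
    "('r \<Rightarrow> 'k::field list \<Rightarrow> bool) \<Rightarrow> 'k list \<Rightarrow> 'k set \<Rightarrow> 'k set \<Rightarrow> bool" where
  "indep R a A B \<longleftrightarrow> \<not> forks R (length a) A (tp R a (A \<union> B))"

text \<open>Only the terms \<open>b i\<close> with \<open>i < l\<close> matter; \<open>l = \<infinity>\<close> means a sequence of length \<open>\<omega>\<close>.\<close>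

definition indep_seq ::
    "('r \<Rightarrow> 'k::field list \<Rightarrow> bool) \<Rightarrow> 'k set \<Rightarrow> enat \<Rightarrow> (nat \<Rightarrow> 'k list) \<Rightarrow> bool" where
  "indep_seq R B l b \<longleftrightarrow> (\<forall>i. enat i < l \<longrightarrow> indep R (b i) B (\<Union>j<i. set (b j)))"


section \<open>Generic types and weight\<close>

definition generic_set :: "'k::field set \<Rightarrow> bool" where
  "generic_set X \<longleftrightarrow> (\<exists>G. finite G \<and> (\<Union>g\<in>G. (+) g ` X) = UNIV)"

text \<open>Genericity in the additive group; in an infinite stable field the generic type of the
  multiplicative group is the same.\<close>

definition generic_type ::
    "('r \<Rightarrow> 'k::field list \<Rightarrow> bool) \<Rightarrow> 'k set \<Rightarrow> ('r, 'k) pfm set \<Rightarrow> bool" where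
  "generic_type R A p \<longleftrightarrow>
     complete_type R A 1 p \<and> (\<forall>\<psi>\<in>p. generic_set {x. holds R \<psi> [x]})"

text \<open>
  The weight of the complete type \<open>p\<close> over \<open>A\<close>, with all infinite cardinals identified to \<open>\<infinity>\<close>. Since
  an initial segment of a witnessing sequence is again witnessing, sequences of length at most
  \<open>\<omega>\<close> suffice for this. The equation \<open>tp R a A = p\<close> says that \<open>tp R a B\<close> extends \<open>p\<close>.
\<close>

definition weight ::
    "'i rel \<Rightarrow> ('r \<Rightarrow> 'k::field list \<Rightarrow> bool) \<Rightarrow> 'k set \<Rightarrow> ('r, 'k) pfm set \<Rightarrow> enat" where
  "weight \<kappa> R A p = Sup {l :: enat. \<exists>a B b.
     A \<subseteq> B \<and> small \<kappa> B \<and> tp R a A = p \<and> \<not> forks R (length a) A (tp R a B) \<and>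
     indep_seq R B l b \<and> (\<forall>i. enat i < l \<longrightarrow> \<not> indep R a A (set (b i)))}"

end

theory Submission imports Defs begin

text \<open>
  Call a definable set generic if finitely many additive translates cover \<open>K\<close>. Without long
  half-graphs, a definable set or its complement is generic, and affine images of a definable set
  fall into finitely many classes modulo nongeneric sets. So some \<open>d \<noteq> 0\<close> fixes all classes under
  translation; scaling \<open>d\<close> shows that every translation does, and hence that the generic sets form
  an ultrafilter on the definable sets, invariant under affine maps.
  If \<open>K\<^sup>q \<noteq> K\<close>, the cosets of the \<open>q\<close>-th powers are then nongeneric and form dividing formulas.

  Given primes \<open>q\<^sub>1, \<dots>, q\<^sub>n\<close> with \<open>K\<^sup>q \<noteq> K\<close>, take independent generics \<open>b\<^sub>1, \<dots>, b\<^sub>n\<close> and let \<open>a\<close> be the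
  product of the \<open>b\<^sub>i ^ f\<^sub>i\<close>, where \<open>f\<^sub>i\<close> is the product of the \<open>q\<^sub>k\<close> with \<open>k \<noteq> i\<close>. The exponents are
  jointly coprime, so this monomial map is onto and \<open>a\<close> is generic. Modulo \<open>q\<^sub>i\<close>-th powers \<open>a\<close> is
  \<open>b\<^sub>i ^ f\<^sub>i\<close> with \<open>f\<^sub>i\<close> prime to \<open>q\<^sub>i\<close>, so \<open>a\<close> depends on each \<open>b\<^sub>i\<close>, and the weight is at least \<open>n\<close>.
\<close>

section \<open>Half-graphs and binary trees\<close>

text \<open>A complete binary tree of height \<open>n\<close>, labelled by parameters from
  \<open>C\<close>, each of whose branches is realised in \<open>Q\<close>. For
  \<open>C = UNIV\<close> the largest such \<open>n\<close> is the Shelah 2-rank of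
  \<open>Q\<close>, also known as Littlestone dimension.\<close>

primrec split_tree :: "('a \<Rightarrow> 'b \<Rightarrow> bool) \<Rightarrow> nat \<Rightarrow> 'b set \<Rightarrow> 'a set \<Rightarrow> bool" where
  "split_tree \<phi> 0 C Q \<longleftrightarrow> Q \<noteq> {}"
| "split_tree \<phi> (Suc n) C Q \<longleftrightarrow>
     (\<exists>b\<in>C. split_tree \<phi> n C {x\<in>Q. \<phi> x b} \<and> split_tree \<phi> n C {x\<in>Q. \<not> \<phi> x b})"

lemma split_tree_mono: "split_tree \<phi> n C Q \<Longrightarrow> C \<subseteq> C' \<Longrightarrow> Q \<subseteq> Q' \<Longrightarrow> split_tree \<phi> n C' Q'"
proof (induction n arbitrary: Q Q')
  case 0
  then show ?case by auto
next
  case (Suc n)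
  then obtain b where b: "b \<in> C" "split_tree \<phi> n C {x\<in>Q. \<phi> x b}" "split_tree \<phi> n C {x\<in>Q. \<not> \<phi> x b}"
    by auto
  have "split_tree \<phi> n C' {x\<in>Q'. \<phi> x b}" "split_tree \<phi> n C' {x\<in>Q'. \<not> \<phi> x b}"
    using Suc.prems by (auto intro: Suc.IH[OF b(2)] Suc.IH[OF b(3)])
  then show ?case using b(1) Suc.prems(2) by auto
qed

lemma split_tree_nonempty: "split_tree \<phi> n C Q \<Longrightarrow> Q \<noteq> {}"
  by (induction n arbitrary: Q) fastforce+

text \<open>A Ramsey property of trees with labels coloured \<open>C1\<close> or \<open>C2\<close>.
  If the root label is in \<open>C1\<close>, apply induction with heights \<open>m - 1\<close> and
  \<open>n\<close> to both subtrees: either one contains a \<open>C2\<close> tree of height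
  \<open>n\<close>, or both contain \<open>C1\<close> trees of height \<open>m - 1\<close>, which
  the root joins.\<close>

lemma split_tree_Un:
  "split_tree \<phi> (m + n) (C1 \<union> C2) Q \<Longrightarrow> split_tree \<phi> m C1 Q \<or> split_tree \<phi> n C2 Q"
proof (induction "m + n" arbitrary: m n Q)
  case 0
  then show ?case by auto
next
  case (Suc k)
  have *: "split_tree \<phi> m C1 Q \<or> split_tree \<phi> n C2 Q" if "m = 0 \<or> n = 0"
    using that split_tree_nonempty[OF Suc.prems] by auto
  obtain b where b: "b \<in> C1 \<union> C2" "split_tree \<phi> k (C1 \<union> C2) {x\<in>Q. \<phi> x b}"
    "split_tree \<phi> k (C1 \<union> C2) {x\<in>Q. \<not> \<phi> x b}"
    using Suc.prems unfolding Suc.hyps(2)[symmetric] split_tree.simps by blast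
  have sub: "{x\<in>Q. \<phi> x b} \<subseteq> Q" "{x\<in>Q. \<not> \<phi> x b} \<subseteq> Q" by auto
  show ?case
  proof (cases "m = 0 \<or> n = 0")
    case True
    then show ?thesis by (rule *)
  next
    case False
    then obtain m' n' where mn: "m = Suc m'" "n = Suc n'" by (cases m; cases n) auto
    then have k: "k = m' + n" "k = m + n'" using Suc.hyps(2) by auto
    show ?thesis
    proof (cases "b \<in> C1")
      case True
      have "split_tree \<phi> m' C1 {x\<in>Q. \<phi> x b} \<or> split_tree \<phi> n C2 {x\<in>Q. \<phi> x b}"
        "split_tree \<phi> m' C1 {x\<in>Q. \<not> \<phi> x b} \<or> split_tree \<phi> n C2 {x\<in>Q. \<not> \<phi> x b}"
        using Suc.hyps(1)[OF k(1), of "{x\<in>Q. \<phi> x b}"] Suc.hyps(1)[OF k(1), of "{x\<in>Q. \<not> \<phi> x b}"]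
          b(2,3) unfolding k(1) by simp_all
      then show ?thesis
        using True split_tree_mono[OF _ order_refl sub(1)] split_tree_mono[OF _ order_refl sub(2)]
        unfolding mn(1) split_tree.simps by blast
    next
      case False
      then have "b \<in> C2" using b by auto
      have "split_tree \<phi> m C1 {x\<in>Q. \<phi> x b} \<or> split_tree \<phi> n' C2 {x\<in>Q. \<phi> x b}"
        "split_tree \<phi> m C1 {x\<in>Q. \<not> \<phi> x b} \<or> split_tree \<phi> n' C2 {x\<in>Q. \<not> \<phi> x b}"
        using Suc.hyps(1)[OF k(2), of "{x\<in>Q. \<phi> x b}"] Suc.hyps(1)[OF k(2), of "{x\<in>Q. \<not> \<phi> x b}"]
          b(2,3) unfolding k(2) by simp_all
      then show ?thesis
        using \<open>b \<in> C2\<close> split_tree_mono[OF _ order_refl sub(1)] split_tree_mono[OF _ order_refl sub(2)]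
        unfolding mn(2) split_tree.simps by blast
    qed
  qed
qed

text \<open>A half-graph as a list. Each entry is compared with all later ones, so that a ladder
  grows by one pair at its head.\<close>

primrec ladder :: "('a \<Rightarrow> 'b \<Rightarrow> bool) \<Rightarrow> ('a \<times> 'b) list \<Rightarrow> bool" where
  "ladder \<phi> [] \<longleftrightarrow> True"
| "ladder \<phi> (p # l) \<longleftrightarrow> \<not> \<phi> (fst p) (snd p) \<and>
     (\<forall>p'\<in>set l. \<phi> (fst p) (snd p') \<and> \<not> \<phi> (fst p') (snd p)) \<and> ladder \<phi> l"

lemma ladder_nth:
  "ladder \<phi> l \<Longrightarrow> i < length l \<Longrightarrow> j < length l \<Longrightarrow> \<phi> (fst (l ! i)) (snd (l ! j)) \<longleftrightarrow> i < j"
proof (induction l arbitrary: i j)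
  case Nil
  then show ?case by simp
next
  case (Cons p l)
  then show ?case by (cases i; cases j) (auto simp: nth_mem)
qed

text \<open>Think of the chosen points and parameters as linearly ordered so that \<open>\<phi> x b\<close> says that \<open>x\<close>
  comes before \<open>b\<close>. The two ladders lie to the left and to the right of a gap in which all points
  of \<open>Q\<close> and all parameters of \<open>C\<close> fit; two levels of the tree and one halving of its parameters
  suffice to extend one of the ladders towards the gap.\<close>

lemma split_tree_ladders:
  "split_tree \<phi> (2 ^ (k + 1) - 2) C Q \<Longrightarrow>
   \<exists>l l'. length l + length l' = k \<and> ladder \<phi> l \<and> ladder (\<lambda>x b. \<not> \<phi> x b) l' \<and>
          set l \<union> set l' \<subseteq> Q \<times> C"
proof (induction k arbitrary: C Q)
  case 0
  then show ?case by auto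
next
  case (Suc k)
  define m where "m = (2::nat) ^ (k + 1) - 2"
  have "(2::nat) ^ k \<ge> 1" by simp
  then have "4 * (2::nat) ^ k - 2 = Suc (Suc (4 * 2 ^ k - 4))" by linarith
  \<comment> \<open>Two levels are spent on \<open>b\<close> and \<open>b'\<close>. The remaining
    height is \<open>m + m\<close>, so that halving the parameters leaves \<open>m\<close>, as the
    induction hypothesis demands.\<close>
  then have "2 ^ (Suc k + 1) - 2 = Suc (Suc (m + m))" by (simp add: m_def)
  then obtain b b' where b: "b \<in> C" "b' \<in> C"
    and t: "split_tree \<phi> (m + m) C {x\<in>{x\<in>Q. \<not> \<phi> x b}. \<phi> x b'}"
    using Suc.prems by auto
  define Q1 Q2 where "Q1 = {x\<in>Q. \<not> \<phi> x b}" and "Q2 = {x\<in>Q1. \<phi> x b'}"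
  obtain x where x: "x \<in> Q2" using split_tree_nonempty[OF t] unfolding Q1_def Q2_def by blast
  have "C = {c\<in>C. \<phi> x c} \<union> {c\<in>C. \<not> \<phi> x c}" by auto
  then have "split_tree \<phi> m {c\<in>C. \<phi> x c} Q2 \<or> split_tree \<phi> m {c\<in>C. \<not> \<phi> x c} Q2"
    using t split_tree_Un[of \<phi> m m "{c\<in>C. \<phi> x c}" "{c\<in>C. \<not> \<phi> x c}" Q2] unfolding Q1_def Q2_def by simp
  then show ?case
  proof
    assume "split_tree \<phi> m {c\<in>C. \<phi> x c} Q2"
    then obtain l l' where l: "length l + length l' = k" "ladder \<phi> l" "ladder (\<lambda>x b. \<not> \<phi> x b) l'"
      "set l \<union> set l' \<subseteq> Q2 \<times> {c\<in>C. \<phi> x c}"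
      using Suc.IH unfolding m_def by blast
    have "ladder \<phi> ((x, b) # l)" using l(2,4) x unfolding Q1_def Q2_def by auto
    moreover have "set ((x, b) # l) \<union> set l' \<subseteq> Q \<times> C" using l(4) b x unfolding Q1_def Q2_def by auto
    ultimately show ?thesis using l(1,3)
      by (intro exI[of _ "(x, b) # l"] exI[of _ l']) auto
  next
    assume "split_tree \<phi> m {c\<in>C. \<not> \<phi> x c} Q2"
    then obtain l l' where l: "length l + length l' = k" "ladder \<phi> l" "ladder (\<lambda>x b. \<not> \<phi> x b) l'"
      "set l \<union> set l' \<subseteq> Q2 \<times> {c\<in>C. \<not> \<phi> x c}"
      using Suc.IH unfolding m_def by blast
    have "ladder (\<lambda>x b. \<not> \<phi> x b) ((x, b') # l')" using l(3,4) x unfolding Q1_def Q2_def by auto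
    moreover have "set l \<union> set ((x, b') # l') \<subseteq> Q \<times> C" using l(4) b x unfolding Q1_def Q2_def by auto
    ultimately show ?thesis using l(1,2)
      by (intro exI[of _ l] exI[of _ "(x, b') # l'"]) auto
  qed
qed

text \<open>The half-graph is built greedily: first a new \<open>b'\<close> related to all earlier
  points, then a new \<open>a'\<close> unrelated to all earlier parameters and to \<open>b'\<close>
  itself, which settles the diagonal.\<close>

lemma half_graph_of_finite_conditions:
  fixes M :: "'a set" and M' :: "'b set"
  assumes "\<And>S. finite S \<Longrightarrow> S \<subseteq> M \<Longrightarrow> \<exists>b\<in>M'. \<forall>a\<in>S. \<phi> a b"
    and "\<And>S. finite S \<Longrightarrow> S \<subseteq> M' \<Longrightarrow> \<exists>a\<in>M. \<forall>b\<in>S. \<not> \<phi> a b"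
  shows "\<exists>a b. (\<forall>i<N. a i \<in> M \<and> b i \<in> M') \<and> (\<forall>i<N. \<forall>j<N. \<phi> (a i) (b j) \<longleftrightarrow> i < (j::nat))"
proof (induction N)
  case 0
  then show ?case by simp
next
  case (Suc N)
  then obtain a b where ab: "\<forall>i<N. a i \<in> M \<and> b i \<in> M'" "\<forall>i<N. \<forall>j<N. \<phi> (a i) (b j) \<longleftrightarrow> i < j"
    by blast
  obtain b' where b': "b' \<in> M'" "\<forall>x\<in>a ` {..<N}. \<phi> x b'"
    using assms(1)[of "a ` {..<N}"] ab(1) by auto
  obtain a' where a': "a' \<in> M" "\<forall>x\<in>insert b' (b ` {..<N}). \<not> \<phi> a' x"
    using assms(2)[of "insert b' (b ` {..<N})"] ab(1) b'(1) by auto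
  show ?case
    using ab a' b' by (intro exI[of _ "a(N := a')"] exI[of _ "b(N := b')"]) (auto simp: less_Suc_eq)
qed

section \<open>Connectedness of the additive group\<close>

lemma generic_set_iff: "generic_set X \<longleftrightarrow> (\<exists>G. finite G \<and> (\<forall>x. \<exists>g\<in>G. x - g \<in> X))"
proof -
  have "x \<in> (+) g ` X \<longleftrightarrow> x - g \<in> X" for x g
    by (auto simp: image_iff intro!: bexI[of _ "x - g"])
  then show ?thesis unfolding generic_set_def set_eq_iff by auto
qed

lemma generic_set_mono: "generic_set X \<Longrightarrow> X \<subseteq> Y \<Longrightarrow> generic_set Y"
  unfolding generic_set_iff by (meson subsetD)

lemma generic_set_UNIV: "generic_set UNIV"
  unfolding generic_set_iff by (intro exI[of _ "{0}"]) auto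

lemma generic_set_affine:
  assumes "generic_set X" "l \<noteq> 0"
  shows "generic_set {x. l * x + h \<in> X}"
proof -
  obtain G where G: "finite G" "\<forall>x. \<exists>g\<in>G. x - g \<in> X" using assms(1) unfolding generic_set_iff by blast
  have "\<exists>g\<in>(\<lambda>g. g / l) ` G. x - g \<in> {x. l * x + h \<in> X}" for x
  proof -
    obtain g where "g \<in> G" "(l * x + h) - g \<in> X" using G(2) by blast
    moreover have "l * (x - g / l) + h = (l * x + h) - g" using assms(2) by (simp add: field_simps)
    ultimately have "x - g / l \<in> {x. l * x + h \<in> X}" by (metis mem_Collect_eq)
    then show ?thesis using \<open>g \<in> G\<close> by blast
  qed
  then show ?thesis unfolding generic_set_iff using G(1) by blast
qed

lemma generic_set_affine_iff:
  assumes "l \<noteq> (0::'k::field)"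
  shows "generic_set {x. l * x + h \<in> X} \<longleftrightarrow> generic_set X"
proof
  assume "generic_set {x. l * x + h \<in> X}"
  then have "generic_set {x. inverse l * x + (- h / l) \<in> {x. l * x + h \<in> X}}"
    by (rule generic_set_affine) (use assms in simp)
  moreover have "l * (inverse l * x + (- h / l)) + h = x" for x using assms by (simp add: field_simps)
  ultimately show "generic_set X" by simp
qed (use generic_set_affine assms in blast)

lemma generic_set_translates:
  assumes "generic_set {x. \<exists>g\<in>G. x - g \<in> X}" "finite G"
  shows "generic_set X"
proof -
  obtain H where H: "finite H" "\<forall>x. \<exists>h\<in>H. \<exists>g\<in>G. x - h - g \<in> X"
    using assms(1) unfolding generic_set_iff mem_Collect_eq by (elim exE conjE)
  have "\<exists>k\<in>(\<lambda>(h, g). h + g) ` (H \<times> G). x - k \<in> X" for x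
  proof -
    obtain h g where "h \<in> H" "g \<in> G" "x - h - g \<in> X" using H(2) by blast
    then show ?thesis by (intro bexI[of _ "h + g"] image_eqI[of _ _ "(h, g)"]) (auto simp: diff_diff_eq)
  qed
  then show ?thesis
    unfolding generic_set_iff using H(1) assms(2)
    by (intro exI[of _ "(\<lambda>(h, g). h + g) ` (H \<times> G)"] conjI finite_imageI finite_cartesian_product allI)
qed

lemma not_generic_singleton: "infinite (UNIV :: 'k::field set) \<Longrightarrow> \<not> generic_set {0 :: 'k}"
proof
  assume inf: "infinite (UNIV :: 'k set)" and "generic_set {0 :: 'k}"
  then obtain G where "finite G" "\<forall>x::'k. \<exists>g\<in>G. x - g = 0" unfolding generic_set_iff by auto
  then have "UNIV \<subseteq> G" by auto
  then show False using inf \<open>finite G\<close> finite_subset by blast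
qed

text \<open>The properties of the family of definable sets from which connectedness follows.
  Stability enters only through \<open>no_half_graph_D\<close>, where points are played against the
  coefficients of affine maps; \<open>l = 1\<close> gives translates and \<open>h = 0\<close>
  dilates.\<close>

locale stable_field_sets =
  fixes D :: "'k::field set set"
  assumes infinite_field: "infinite (UNIV :: 'k set)"
    and zero_D: "{0} \<in> D"
    and Compl_D: "X \<in> D \<Longrightarrow> - X \<in> D"
    and Int_D: "X \<in> D \<Longrightarrow> Y \<in> D \<Longrightarrow> X \<inter> Y \<in> D"
    and affine_D: "X \<in> D \<Longrightarrow> {x. l * x + h \<in> X} \<in> D"
    and no_half_graph_D: "X \<in> D \<Longrightarrow>
      \<exists>N. \<not> (\<exists>x l h. \<forall>i<N. \<forall>j<N. l j * x i + h j \<in> X \<longleftrightarrow> i < (j :: nat))"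
begin

lemma Un_D: "X \<in> D \<Longrightarrow> Y \<in> D \<Longrightarrow> X \<union> Y \<in> D"
  using Compl_D[OF Int_D[OF Compl_D Compl_D, of X Y]] by simp

lemma Diff_D: "X \<in> D \<Longrightarrow> Y \<in> D \<Longrightarrow> X - Y \<in> D"
  using Int_D[OF _ Compl_D, of X Y] by (simp add: Diff_eq)

lemma empty_D: "{} \<in> D"
  using Int_D[OF zero_D Compl_D[OF zero_D]] by simp

lemma UNIV_D: "UNIV \<in> D"
  using Compl_D[OF empty_D] by simp

lemma Union_D: "finite F \<Longrightarrow> F \<subseteq> D \<Longrightarrow> \<Union>F \<in> D"
  by (induction F rule: finite_induct) (auto simp: empty_D Un_D)

lemma translates_D:
  assumes "X \<in> D" "finite G"
  shows "{x. \<exists>g\<in>G. x - g \<in> X} \<in> D"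
proof -
  have "\<Union>((\<lambda>g. {x. 1 * x + (- g) \<in> X}) ` G) \<in> D"
    by (rule Union_D) (use assms affine_D in blast)+
  moreover have "\<Union>((\<lambda>g. {x. 1 * x + (- g) \<in> X}) ` G) = {x. \<exists>g\<in>G. x - g \<in> X}" by auto
  ultimately show ?thesis by simp
qed

lemma generic_nonempty: "generic_set X \<Longrightarrow> X \<noteq> ({} :: 'k set)"
  using generic_set_mono[of "{}" "{0 :: 'k}"] not_generic_singleton[OF infinite_field] by auto

text \<open>If neither set is generic, then no finitely many translates of either cover the field.
  So for every finite \<open>S\<close> some \<open>b\<close> puts all of \<open>S + b\<close> into
  \<open>X\<close>, and another puts all of it outside, which yields arbitrarily long half-graphs
  for \<open>a + b \<in> X\<close>.\<close>

lemma generic_or_Compl: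
  assumes "X \<in> D"
  shows "generic_set X \<or> generic_set (- X)"
proof (rule ccontr)
  assume n: "\<not> ?thesis"
  have *: "\<exists>b\<in>UNIV. \<forall>a\<in>S. 1 * a + b \<notin> Y" if Y: "\<not> generic_set Y" and "finite S" for S and Y :: "'k set"
  proof -
    define G where "G = uminus ` S"
    have "finite G" using \<open>finite S\<close> unfolding G_def by simp
    then obtain b where "\<forall>g\<in>G. b - g \<notin> Y" using Y unfolding generic_set_iff by blast
    then have "\<forall>a\<in>S. 1 * a + b \<notin> Y" unfolding G_def by (simp add: add.commute)
    then show ?thesis by blast
  qed
  obtain N where N: "\<not> (\<exists>x l h. \<forall>i<N. \<forall>j<N. l j * x i + h j \<in> X \<longleftrightarrow> i < (j :: nat))"
    using no_half_graph_D[OF assms] by blast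
  have "\<exists>a b. (\<forall>i<N. a i \<in> UNIV \<and> b i \<in> UNIV) \<and> (\<forall>i<N. \<forall>j<N. 1 * a i + b j \<in> X \<longleftrightarrow> i < j)"
  proof (rule half_graph_of_finite_conditions)
    fix S :: "'k set" assume "finite S"
    then show "\<exists>b\<in>UNIV. \<forall>a\<in>S. 1 * a + b \<in> X" using *[of "- X" S] n by auto
    show "\<exists>a\<in>UNIV. \<forall>b\<in>S. 1 * a + b \<notin> X" using *[of X S] n \<open>finite S\<close> by (auto simp: add.commute)
  qed
  then show False using N[unfolded not_ex, rule_format, of "\<lambda>_. 1"] by blast
qed

text \<open>If \<open>X\<close> is not generic, neither is a union \<open>X'\<close> of finitely
  many translates of it, so \<open>- X'\<close> is generic. When translates of
  \<open>X \<union> Y\<close> cover the field, those of \<open>Y\<close> cover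
  \<open>- X'\<close>.\<close>

lemma generic_Un:
  assumes "generic_set (X \<union> Y)" "X \<in> D" "Y \<in> D"
  shows "generic_set X \<or> generic_set Y"
proof (rule ccontr)
  assume n: "\<not> ?thesis"
  obtain G where G: "finite G" "\<forall>x. \<exists>g\<in>G. x - g \<in> X \<union> Y"
    using assms(1) unfolding generic_set_iff by blast
  define X' where "X' = {x. \<exists>g\<in>G. x - g \<in> X}"
  have "\<not> generic_set X'" using generic_set_translates[OF _ G(1)] n unfolding X'_def by blast
  then have "generic_set (- X')"
    using generic_or_Compl[OF translates_D[OF assms(2) G(1)]] unfolding X'_def by blast
  moreover have "- X' \<subseteq> {x. \<exists>g\<in>G. x - g \<in> Y}" using G(2) unfolding X'_def by auto
  ultimately have "generic_set {x. \<exists>g\<in>G. x - g \<in> Y}" by (rule generic_set_mono)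
  then have "generic_set Y" using G(1) by (rule generic_set_translates)
  then show False using n by blast
qed

lemma generic_Union:
  assumes "generic_set (\<Union>F)" "finite F" "F \<subseteq> D"
  shows "\<exists>X\<in>F. generic_set X"
  using assms(2,1,3)
proof (induction F rule: finite_induct)
  case empty
  then show ?case using generic_nonempty[of "\<Union>{}"] by simp
next
  case (insert X F)
  have "\<Union>F \<in> D" using insert.hyps(1) insert.prems(2) Union_D by auto
  then have "generic_set X \<or> generic_set (\<Union>F)" using generic_Un[of X "\<Union>F"] insert.prems by auto
  then show ?case using insert.IH insert.prems(2) by auto
qed

text \<open>Otherwise every generic set of \<open>D\<close> is cut by some affine image of
  \<open>X\<close> into two generic pieces. Repeating this from \<open>UNIV\<close> gives binary
  trees of every height, hence long half-graphs for \<open>X\<close> or for its complement.\<close>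

lemma ex_unsplittable:
  assumes "X \<in> D"
  shows "\<exists>Z\<in>D. generic_set Z \<and>
    (\<forall>l h. l \<noteq> 0 \<longrightarrow> \<not> (generic_set (Z \<inter> {x. l * x + h \<in> X}) \<and> generic_set (Z \<inter> {x. l * x + h \<notin> X})))"
proof (rule ccontr)
  assume n: "\<not> ?thesis"
  define \<phi> where "\<phi> = (\<lambda>x (l, h). l * x + h \<in> X)"
  have tree: "split_tree \<phi> n UNIV Z" if "generic_set Z" "Z \<in> D" for n Z
    using that
  proof (induction n arbitrary: Z)
    case 0
    then show ?case using generic_set_mono[of Z "{0}"] not_generic_singleton[OF infinite_field] by auto
  next
    case (Suc n)
    then obtain l h where lh: "generic_set (Z \<inter> {x. l * x + h \<in> X})"
      "generic_set (Z \<inter> {x. l * x + h \<notin> X})" using n by blast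
    have "{x. l * x + h \<notin> X} = - {x. l * x + h \<in> X}" by auto
    then have "Z \<inter> {x. l * x + h \<in> X} \<in> D" "Z \<inter> {x. l * x + h \<notin> X} \<in> D"
      using affine_D[OF assms, of l h] Compl_D Int_D Suc.prems by auto
    then have "split_tree \<phi> n UNIV (Z \<inter> {x. l * x + h \<in> X})"
      "split_tree \<phi> n UNIV (Z \<inter> {x. l * x + h \<notin> X})" using Suc.IH lh by auto
    then have "split_tree \<phi> n UNIV {x\<in>Z. \<phi> x (l, h)}" "split_tree \<phi> n UNIV {x\<in>Z. \<not> \<phi> x (l, h)}"
      by (simp_all add: \<phi>_def Int_def)
    then show ?case unfolding split_tree.simps by blast
  qed
  have long: "\<exists>x l h. \<forall>i<N. \<forall>j<N. l j * x i + h j \<in> Y \<longleftrightarrow> i < (j :: nat)"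
    if l: "ladder \<psi> l" and "N \<le> length l" and \<psi>: "\<And>x b. \<psi> x b \<longleftrightarrow> fst b * x + snd b \<in> Y" for \<psi> l N Y
    using ladder_nth[OF l] that(2) unfolding \<psi>
    by (intro exI[of _ "\<lambda>i. fst (l ! i)"] exI[of _ "\<lambda>i. fst (snd (l ! i))"] exI[of _ "\<lambda>i. snd (snd (l ! i))"])
      simp
  obtain N where N: "\<not> (\<exists>x l h. \<forall>i<N. \<forall>j<N. l j * x i + h j \<in> X \<longleftrightarrow> i < (j :: nat))"
    using no_half_graph_D[OF assms] by blast
  \<comment> \<open>A ladder for the negation of \<open>\<phi>\<close> is a half-graph for the
    complement of \<open>X\<close>, which has its own bound \<open>N'\<close>.\<close>
  obtain N' where N': "\<not> (\<exists>x l h. \<forall>i<N'. \<forall>j<N'. l j * x i + h j \<in> - X \<longleftrightarrow> i < (j :: nat))"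
    using no_half_graph_D[OF Compl_D[OF assms]] by blast
  obtain l l' where l: "length l + length l' = N + N'" "ladder \<phi> l" "ladder (\<lambda>x b. \<not> \<phi> x b) l'"
    using split_tree_ladders[OF tree[OF generic_set_UNIV UNIV_D]] by blast
  have "\<phi> x b \<longleftrightarrow> fst b * x + snd b \<in> X" "\<not> \<phi> x b \<longleftrightarrow> fst b * x + snd b \<in> - X" for x b
    by (auto simp: \<phi>_def split: prod.splits)
  then have "\<not> N \<le> length l" "\<not> N' \<le> length l'"
    using long[OF l(2), of N X] N long[OF l(3), of N' "- X"] N' by argo+
  then show False using l(1) by simp
qed

section \<open>Equality modulo nongeneric sets\<close>

definition eq_generic :: "'k set \<Rightarrow> 'k set \<Rightarrow> bool" where
  "eq_generic X Y \<longleftrightarrow> \<not> generic_set (X - Y) \<and> \<not> generic_set (Y - X)"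

lemma eq_generic_sym: "eq_generic X Y \<Longrightarrow> eq_generic Y X"
  unfolding eq_generic_def by auto

lemma eq_generic_trans:
  assumes "eq_generic X Y" "eq_generic Y Z" "X \<in> D" "Y \<in> D" "Z \<in> D"
  shows "eq_generic X Z"
proof -
  have "X - Z \<subseteq> (X - Y) \<union> (Y - Z)" "Z - X \<subseteq> (Z - Y) \<union> (Y - X)" by auto
  then show ?thesis
    using assms generic_set_mono[of "X - Z"] generic_set_mono[of "Z - X"]
      generic_Un[of "X - Y" "Y - Z"] generic_Un[of "Z - Y" "Y - X"] Diff_D
    unfolding eq_generic_def by blast
qed

lemma eq_generic_affine:
  assumes "eq_generic X Y" "l \<noteq> 0"
  shows "eq_generic {x. l * x + h \<in> X} {x. l * x + h \<in> Y}"
proof -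
  have "{x. l * x + h \<in> X} - {x. l * x + h \<in> Y} = {x. l * x + h \<in> X - Y}" for X Y by auto
  then show ?thesis using assms unfolding eq_generic_def by (simp only: generic_set_affine_iff not_False_eq_True)
qed

text \<open>Finitely many translates of an unsplittable generic set cover the field, and an affine image of
  \<open>X\<close> is determined modulo nongeneric sets by which of these translates it almost contains.\<close>

lemma ex_signature:
  assumes "X \<in> D"
  shows "\<exists>(G :: 'k set) s. finite G \<and> (\<forall>l h. s l h \<subseteq> G) \<and>
    (\<forall>l h l' h'. l \<noteq> 0 \<longrightarrow> l' \<noteq> 0 \<longrightarrow> s l h = s l' h' \<longrightarrow>
       eq_generic {x. l * x + h \<in> X} {x. l' * x + h' \<in> X})"
proof -
  obtain Z where Z: "Z \<in> D" "generic_set Z" and unsplit: "\<And>l h. l \<noteq> 0 \<Longrightarrow>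
      \<not> (generic_set (Z \<inter> {x. l * x + h \<in> X}) \<and> generic_set (Z \<inter> {x. l * x + h \<notin> X}))"
    using ex_unsplittable[OF assms] by blast
  obtain G where G: "finite G" "\<forall>x. \<exists>g\<in>G. x - g \<in> Z" using Z(2) unfolding generic_set_iff by blast
  define T where "T g = {x. 1 * x + - g \<in> Z}" for g
  define s where "s l h = {g\<in>G. generic_set (T g \<inter> {x. l * x + h \<in> X})}" for l h
  have TD: "T g \<in> D" for g unfolding T_def using Z(1) by (rule affine_D)
  have not_both: "\<not> (generic_set (T g \<inter> {x. l * x + h \<in> X}) \<and> generic_set (T g \<inter> {x. l * x + h \<notin> X}))"
    if "l \<noteq> 0" for g l h
  proof -
    \<comment> \<open>Translating \<open>T g\<close> back to \<open>Z\<close> changes only the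
      constant term of the affine map, and \<open>Z\<close> is unsplittable for every constant
      term.\<close>
    have shift: "generic_set (T g \<inter> {x. P (l * x + h)}) \<longleftrightarrow> generic_set (Z \<inter> {x. P (l * x + (l * g + h))})" for P
    proof -
      have "{x. 1 * x + g \<in> T g \<inter> {x. P (l * x + h)}} = Z \<inter> {x. P (l * x + (l * g + h))}"
        unfolding T_def by (auto simp: algebra_simps)
      then show ?thesis using generic_set_affine_iff[of 1 g "T g \<inter> {x. P (l * x + h)}"] by simp
    qed
    show ?thesis using shift[of "\<lambda>z. z \<in> X"] shift[of "\<lambda>z. z \<notin> X"] unsplit[OF that] by simp
  qed
  have one_side: "\<not> generic_set ({x. l * x + h \<in> X} - {x. l' * x + h' \<in> X})"
    if "l' \<noteq> 0" "s l h = s l' h'" for l h l' h'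
  proof
    let ?E = "{x. l * x + h \<in> X} - {x. l' * x + h' \<in> X}"
    assume gen: "generic_set ?E"
    \<comment> \<open>A generic difference would be generic inside some \<open>T g\<close>. Then
      \<open>g\<close> lies in both signatures, and the second affine image splits
      \<open>T g\<close>.\<close>
    have "?E \<subseteq> \<Union>((\<lambda>g. T g \<inter> ?E) ` G)" using G(2) unfolding T_def by fastforce
    with gen have "generic_set (\<Union>((\<lambda>g. T g \<inter> ?E) ` G))" by (rule generic_set_mono)
    moreover have "(\<lambda>g. T g \<inter> ?E) ` G \<subseteq> D" using TD affine_D[OF assms] Diff_D Int_D by blast
    ultimately obtain g where g: "g \<in> G" "generic_set (T g \<inter> ?E)"
      using generic_Union[of "(\<lambda>g. T g \<inter> ?E) ` G"] G(1) by auto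
    have "generic_set (T g \<inter> {x. l * x + h \<in> X})" by (rule generic_set_mono[OF g(2)]) blast
    then have "g \<in> s l h" unfolding s_def using g(1) by simp
    then have "generic_set (T g \<inter> {x. l' * x + h' \<in> X})" using that(2) unfolding s_def by simp
    moreover have "generic_set (T g \<inter> {x. l' * x + h' \<notin> X})" by (rule generic_set_mono[OF g(2)]) blast
    ultimately show False using not_both[OF that(1)] by blast
  qed
  show ?thesis
  proof (intro exI[of _ G] exI[of _ s] conjI allI impI)
    show "s l h \<subseteq> G" for l h unfolding s_def by blast
    show "eq_generic {x. l * x + h \<in> X} {x. l' * x + h' \<in> X}"
      if "l \<noteq> 0" "l' \<noteq> 0" "s l h = s l' h'" for l h l' h'
      using one_side[OF that(2,3)] one_side[OF that(1) that(3)[symmetric]] unfolding eq_generic_def by argo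
  qed (fact G(1))
qed

text \<open>Translation permutes the finitely many classes of affine images of \<open>X\<close>, so some \<open>d \<noteq> 0\<close> fixes
  them all; rescaling turns \<open>d\<close> into an arbitrary element.\<close>

lemma eq_generic_translate:
  assumes "X \<in> D"
  shows "eq_generic X {x. x + e \<in> X}"
proof (cases "e = 0")
  case True
  then show ?thesis using generic_nonempty by (auto simp: eq_generic_def)
next
  case False
  obtain G :: "'k set" and s where G: "finite G" "\<And>l h. s l h \<subseteq> G"
    and s: "\<And>l h l' h'. l \<noteq> 0 \<Longrightarrow> l' \<noteq> 0 \<Longrightarrow> s l h = s l' h' \<Longrightarrow>
       eq_generic {x. l * x + h \<in> X} {x. l' * x + h' \<in> X}"
    using ex_signature[OF assms] by blast
  \<comment> \<open>\<open>F c\<close> is translation by \<open>c\<close>, recorded as a relation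
    between the signatures of an affine image of \<open>X\<close> and of its translate. There are
    finitely many such relations, so two elements \<open>c\<close> and \<open>c'\<close> share
    theirs.\<close>
  define F where "F c = {(s l h, s l (h + l * c)) | l h. l \<noteq> 0}" for c
  have "range F \<subseteq> Pow (Pow G \<times> Pow G)" using G(2) unfolding F_def by blast
  then have "finite (range F)" using G(1) by (meson finite_Pow_iff finite_SigmaI finite_subset)
  then have "\<not> inj F" using infinite_field finite_imageD by blast
  then obtain c c' where c: "F c = F c'" "c \<noteq> c'" unfolding inj_def by blast
  \<comment> \<open>Dilating by this \<open>l\<close> turns the difference \<open>c - c'\<close>
    into \<open>e\<close>.\<close>
  define l where "l = e / (c - c')"
  have l: "l \<noteq> 0" using False c(2) unfolding l_def by simp
  have lc: "l * (c - c') = e" using c(2) unfolding l_def by simp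
  have "(s l 0, s l (0 + l * c)) \<in> F c" unfolding F_def using l by blast
  \<comment> \<open>As the pair also lies in \<open>F c'\<close>, it comes from some
    \<open>l'\<close> and \<open>h'\<close>. The images for \<open>l * x + l * c'\<close> and for
    \<open>l * x + l * c\<close> are then both equivalent to the one for
    \<open>l' * x + (h' + l' * c')\<close>.\<close>
  then obtain l' h' where l': "l' \<noteq> 0" "s l 0 = s l' h'" "s l (l * c) = s l' (h' + l' * c')"
    unfolding c(1) unfolding F_def by auto
  have "eq_generic {x. l * x + 0 \<in> X} {x. l' * x + h' \<in> X}" using s l l' by blast
  from eq_generic_affine[OF this, of 1 c']
  have 1: "eq_generic {x. l * x + l * c' \<in> X} {x. l' * x + (h' + l' * c') \<in> X}" by (simp add: algebra_simps)
  have 2: "eq_generic {x. l' * x + (h' + l' * c') \<in> X} {x. l * x + l * c \<in> X}"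
    by (rule eq_generic_sym) (use s l l' in blast)
  have "eq_generic {x. l * x + l * c' \<in> X} {x. l * x + l * c \<in> X}"
    using eq_generic_trans[OF 1 2] affine_D[OF assms] by blast
  \<comment> \<open>Substituting \<open>x / l - c'\<close> turns the first image into
    \<open>X\<close> and the second into its translate by \<open>e\<close>.\<close>
  from eq_generic_affine[OF this, of "inverse l" "- c'"]
  have "eq_generic {x. l * (inverse l * x + - c') + l * c' \<in> X} {x. l * (inverse l * x + - c') + l * c \<in> X}"
    using l by simp
  moreover have "l * (inverse l * x + - c') + l * c' = x" "l * (inverse l * x + - c') + l * c = x + e" for x
    using l lc by (simp_all add: algebra_simps)
  ultimately show ?thesis by simp
qed

text \<open>Finitely many translates of \<open>X\<close> cover \<open>- X\<close>. If
  \<open>- X\<close> were generic, one of them would contain a generic part of it, although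
  \<open>X\<close> and its translates agree modulo nongeneric sets.\<close>

lemma not_generic_Compl:
  assumes "X \<in> D" "generic_set X"
  shows "\<not> generic_set (- X)"
proof
  assume gen: "generic_set (- X)"
  obtain G where G: "finite G" "\<forall>x. \<exists>g\<in>G. x - g \<in> X" using assms(2) unfolding generic_set_iff by blast
  define T where "T g = {x. 1 * x + - g \<in> X} - X" for g
  have "- X \<subseteq> \<Union>(T ` G)" using G(2) unfolding T_def by fastforce
  with gen have "generic_set (\<Union>(T ` G))" by (rule generic_set_mono)
  moreover have "T ` G \<subseteq> D" unfolding T_def using affine_D[OF assms(1)] Diff_D assms(1) by blast
  ultimately obtain g where "generic_set (T g)" using generic_Union[of "T ` G"] G(1) by auto
  then show False using eq_generic_translate[OF assms(1), of "- g"] unfolding T_def eq_generic_def by simp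
qed

lemma generic_Compl_iff: "X \<in> D \<Longrightarrow> generic_set (- X) \<longleftrightarrow> \<not> generic_set X"
  using generic_or_Compl[of X] not_generic_Compl[of X] by argo

lemma generic_Int:
  assumes "X \<in> D" "Y \<in> D" "generic_set X" "generic_set Y"
  shows "generic_set (X \<inter> Y)"
proof -
  have "\<not> generic_set (- X \<union> - Y)"
    using generic_Un[of "- X" "- Y"] not_generic_Compl[of X] not_generic_Compl[of Y] Compl_D[of X] Compl_D[of Y] assms by argo
  then show ?thesis using generic_Compl_iff[OF Int_D[OF assms(1,2)]] by (simp add: Compl_Int)
qed

lemma generic_Inter:
  assumes "finite F" "F \<subseteq> D" "\<forall>X\<in>F. generic_set X"
  shows "\<Inter>F \<in> D \<and> generic_set (\<Inter>F)"
  using assms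
proof (induction F rule: finite_induct)
  case empty
  then show ?case by (simp add: UNIV_D generic_set_UNIV)
next
  case (insert X F)
  then have "X \<in> D" "generic_set X" "\<Inter>F \<in> D" "generic_set (\<Inter>F)" by simp_all
  then show ?case using Int_D[of X "\<Inter>F"] generic_Int[of X "\<Inter>F"] by simp
qed

text \<open>No finite set of multipliers works for \<open>- X\<close>, as otherwise
  \<open>{0}\<close> and finitely many dilates of this nongeneric set would cover the field. If none
  worked for \<open>X\<close> either, the relation \<open>b * a \<in> X\<close> on nonzero elements
  would contain arbitrarily long half-graphs.\<close>

lemma generic_multiplicative:
  assumes "X \<in> D" "generic_set X"
  shows "\<exists>T. finite T \<and> 0 \<notin> T \<and> (\<forall>x. x \<noteq> 0 \<longrightarrow> (\<exists>t\<in>T. t * x \<in> X))"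
proof (rule ccontr)
  assume n: "\<not> ?thesis"
  have c: "\<not> (\<exists>T. finite T \<and> 0 \<notin> T \<and> (\<forall>x. x \<noteq> 0 \<longrightarrow> (\<exists>t\<in>T. t * x \<notin> X)))"
  proof
    assume "\<exists>T. finite T \<and> 0 \<notin> T \<and> (\<forall>x. x \<noteq> 0 \<longrightarrow> (\<exists>t\<in>T. t * x \<notin> X))"
    then obtain T where T: "finite T" "0 \<notin> T" "\<forall>x. x \<noteq> 0 \<longrightarrow> (\<exists>t\<in>T. t * x \<notin> X)" by blast
    define E where "E t = {x. t * x + 0 \<in> - X}" for t
    have "UNIV = \<Union>(insert {0} (E ` T))" using T(3) unfolding E_def by auto
    moreover have "insert {0} (E ` T) \<subseteq> D" unfolding E_def
      using affine_D[OF Compl_D[OF assms(1)]] zero_D by blast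
    ultimately have "\<exists>Y\<in>insert {0} (E ` T). generic_set Y"
      using generic_Union[of "insert {0} (E ` T)"] generic_set_UNIV T(1) by auto
    then obtain t where t: "t \<in> T" "generic_set (E t)" using not_generic_singleton[OF infinite_field] by auto
    moreover from t(1) T(2) have "t \<noteq> 0" by metis
    ultimately have "generic_set (- X)" unfolding E_def using generic_set_affine_iff[of t 0 "- X"] by metis
    then show False using not_generic_Compl[OF assms] by argo
  qed
  obtain N where N: "\<not> (\<exists>x l h. \<forall>i<N. \<forall>j<N. l j * x i + h j \<in> X \<longleftrightarrow> i < (j :: nat))"
    using no_half_graph_D[OF assms(1)] by blast
  have "\<exists>a b. (\<forall>i<N. a i \<in> - {0} \<and> b i \<in> - {0}) \<and> (\<forall>i<N. \<forall>j<N. b j * a i + 0 \<in> X \<longleftrightarrow> i < j)"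
  proof (rule half_graph_of_finite_conditions)
    fix S :: "'k set" assume S: "finite S" "S \<subseteq> - {0}"
    then show "\<exists>b\<in>- {0}. \<forall>a\<in>S. b * a + 0 \<in> X" using c[unfolded not_ex, rule_format, of S] by (auto simp: mult.commute)
    show "\<exists>a\<in>- {0}. \<forall>b\<in>S. b * a + 0 \<notin> X" using n[unfolded not_ex, rule_format, of S] S by auto
  qed
  then obtain a b where "\<forall>i<N. \<forall>j<N. b j * a i + 0 \<in> X \<longleftrightarrow> i < j" by blast
  then show False using N[unfolded not_ex, rule_format, of b a "\<lambda>_. 0"] by blast
qed

end

section \<open>Definable sets\<close>

lemma finite_tm_vars: "finite (tm_vars t)"
  by (induction t) auto

lemma finite_free_vars: "finite (free_vars \<phi>)"
  by (induction \<phi>) (auto simp: finite_tm_vars)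

lemma tm_val_cong: "(\<And>i. i \<in> tm_vars t \<Longrightarrow> e i = e' i) \<Longrightarrow> tm_val e t = tm_val e' t"
  by (induction t) auto

lemma sat_cong: "(\<And>i. i \<in> free_vars \<phi> \<Longrightarrow> e i = e' i) \<Longrightarrow> sat R e \<phi> \<longleftrightarrow> sat R e' \<phi>"
proof (induction \<phi> arbitrary: e e')
  case (Eq s t)
  then have "tm_val e s = tm_val e' s" "tm_val e t = tm_val e' t" by (auto intro!: tm_val_cong)
  then show ?case by simp
next
  case (Rel r ts)
  then have "map (tm_val e) ts = map (tm_val e') ts" by (auto intro!: tm_val_cong)
  then show ?case by (simp only: sat.simps)
next
  case (Neg \<phi>)
  then show ?case by (metis free_vars.simps(3) sat.simps(3))
next
  case (Conj \<phi> \<psi>)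
  have "sat R e \<phi> = sat R e' \<phi>" "sat R e \<psi> = sat R e' \<psi>"
    using Conj.prems by (auto intro!: Conj.IH)
  then show ?case by simp
next
  case (Exists i \<phi>)
  have "sat R (e(i := x)) \<phi> = sat R (e'(i := x)) \<phi>" for x
    using Exists.prems by (auto intro!: Exists.IH)
  then show ?case by simp
qed

primrec tm_subst :: "(nat \<Rightarrow> tm) \<Rightarrow> tm \<Rightarrow> tm" where
  "tm_subst \<tau> (Var i) = \<tau> i"
| "tm_subst \<tau> Zero = Zero"
| "tm_subst \<tau> One = One"
| "tm_subst \<tau> (Minus t) = Minus (tm_subst \<tau> t)"
| "tm_subst \<tau> (Plus s t) = Plus (tm_subst \<tau> s) (tm_subst \<tau> t)"
| "tm_subst \<tau> (Times s t) = Times (tm_subst \<tau> s) (tm_subst \<tau> t)"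

lemma tm_vars_subst: "tm_vars (tm_subst \<tau> t) = (\<Union>i\<in>tm_vars t. tm_vars (\<tau> i))"
  by (induction t) auto

lemma tm_val_subst: "tm_val e (tm_subst \<tau> t) = tm_val (\<lambda>i. tm_val e (\<tau> i)) t"
  by (induction t) auto

text \<open>Substitution is stated as an existence claim: at each quantifier the bound variable is
  replaced by one fresh for all terms substituted, which avoids capture.\<close>

lemma ex_subst:
  "\<exists>\<phi>'. free_vars \<phi>' \<subseteq> (\<Union>i\<in>free_vars \<phi>. tm_vars (\<tau> i)) \<and>
     (\<forall>e. sat R e \<phi>' \<longleftrightarrow> sat R (\<lambda>i. tm_val e (\<tau> i)) \<phi>)"
proof (induction \<phi> arbitrary: \<tau>)
  case (Eq s t)
  show ?case by (intro exI[of _ "Eq (tm_subst \<tau> s) (tm_subst \<tau> t)"]) (simp add: tm_vars_subst tm_val_subst)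
next
  case (Rel r ts)
  have "sat R e (Rel r (map (tm_subst \<tau>) ts)) \<longleftrightarrow> sat R (\<lambda>i. tm_val e (\<tau> i)) (Rel r ts)" for e
    by (simp add: tm_val_subst comp_def)
  then show ?case by (intro exI[of _ "Rel r (map (tm_subst \<tau>) ts)"]) (simp add: tm_vars_subst)
next
  case (Neg \<phi>)
  obtain \<phi>' where "free_vars \<phi>' \<subseteq> (\<Union>i\<in>free_vars \<phi>. tm_vars (\<tau> i))"
     "\<forall>e. sat R e \<phi>' \<longleftrightarrow> sat R (\<lambda>i. tm_val e (\<tau> i)) \<phi>" using Neg.IH by blast
  then show ?case by (intro exI[of _ "Neg \<phi>'"]) simp
next
  case (Conj \<phi> \<psi>)
  obtain \<phi>' where "free_vars \<phi>' \<subseteq> (\<Union>i\<in>free_vars \<phi>. tm_vars (\<tau> i))"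
     "\<forall>e. sat R e \<phi>' \<longleftrightarrow> sat R (\<lambda>i. tm_val e (\<tau> i)) \<phi>" using Conj.IH(1) by blast
  moreover obtain \<psi>' where "free_vars \<psi>' \<subseteq> (\<Union>i\<in>free_vars \<psi>. tm_vars (\<tau> i))"
     "\<forall>e. sat R e \<psi>' \<longleftrightarrow> sat R (\<lambda>i. tm_val e (\<tau> i)) \<psi>" using Conj.IH(2) by blast
  ultimately show ?case by (intro exI[of _ "Conj \<phi>' \<psi>'"]) auto
next
  case (Exists i \<phi>)
  define W where "W = (\<Union>j\<in>free_vars \<phi>. tm_vars (\<tau> j))"
  have "finite W" unfolding W_def by (simp add: finite_free_vars finite_tm_vars)
  then obtain m where m: "m \<notin> W" using ex_new_if_finite infinite_UNIV_nat by blast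
  obtain \<phi>' where \<phi>': "free_vars \<phi>' \<subseteq> (\<Union>j\<in>free_vars \<phi>. tm_vars ((\<tau>(i := Var m)) j))"
     "\<And>e. sat R e \<phi>' \<longleftrightarrow> sat R (\<lambda>j. tm_val e ((\<tau>(i := Var m)) j)) \<phi>" using Exists.IH by blast
  have "sat R (e(m := x)) \<phi>' \<longleftrightarrow> sat R ((\<lambda>j. tm_val e (\<tau> j))(i := x)) \<phi>" for e x
    unfolding \<phi>'(2) using m by (intro sat_cong) (auto simp: W_def intro!: tm_val_cong)
  moreover have "free_vars \<phi>' - {m} \<subseteq> (\<Union>j\<in>free_vars \<phi> - {i}. tm_vars (\<tau> j))"
    using \<phi>'(1) by (auto split: if_splits)
  ultimately show ?case by (intro exI[of _ "Exists m \<phi>'"]) simp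
qed

lemma ex_affine_formula:
  assumes "free_vars \<phi> \<subseteq> {..<1 + n}"
  shows "\<exists>\<phi>'. free_vars \<phi>' \<subseteq> {..<1 + (n + 2)} \<and>
    (\<forall>c l h x. length c = n \<longrightarrow> (holds R (\<phi>', c @ [l, h]) [x] \<longleftrightarrow> holds R (\<phi>, c) [l * x + h]))"
proof -
  \<comment> \<open>Variable 0 is the point and 1 to \<open>n\<close> are the old parameters; the
    coefficients \<open>l\<close> and \<open>h\<close> follow as \<open>n + 1\<close> and
    \<open>n + 2\<close>.\<close>
  define \<tau> where "\<tau> i = (if i = 0 then Plus (Times (Var (n + 1)) (Var 0)) (Var (n + 2)) else Var i)" for i
  obtain \<phi>' where \<phi>': "free_vars \<phi>' \<subseteq> (\<Union>i\<in>free_vars \<phi>. tm_vars (\<tau> i))"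
    "\<And>e. sat R e \<phi>' \<longleftrightarrow> sat R (\<lambda>i. tm_val e (\<tau> i)) \<phi>"
    using ex_subst[of \<tau> \<phi> R] by auto
  have "free_vars \<phi>' \<subseteq> {..<1 + (n + 2)}"
    using \<phi>'(1) assms by (force simp: \<tau>_def split: if_splits)
  moreover have "holds R (\<phi>', c @ [l, h]) [x] \<longleftrightarrow> holds R (\<phi>, c) [l * x + h]" if "length c = n" for c l h x
    unfolding holds_def fst_conv \<phi>'(2) using assms that
    by (intro sat_cong) (auto simp: \<tau>_def assign_def nth_append nth_Cons' dest!: subsetD)
  ultimately show ?thesis by blast
qed

section \<open>Definable sets of elements\<close>

definition definable_sets :: "('r \<Rightarrow> 'k::field list \<Rightarrow> bool) \<Rightarrow> 'k set set" where
  "definable_sets R = (\<lambda>\<psi>. {x. holds R \<psi> [x]}) ` formulas_over UNIV 1"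

lemma definable_setsI: "\<psi> \<in> formulas_over C 1 \<Longrightarrow> {x. holds R \<psi> [x]} \<in> definable_sets R"
  unfolding definable_sets_def formulas_over_def by (intro image_eqI[of _ _ \<psi>]) auto

lemma definable_setsE:
  assumes "X \<in> definable_sets R"
  obtains \<phi> c where "free_vars \<phi> \<subseteq> {..<1 + length c}" "X = {x. holds R (\<phi>, c) [x]}"
  using assms unfolding definable_sets_def formulas_over_def by auto

lemma Neg_formulas_over: "(\<phi>, c) \<in> formulas_over A n \<Longrightarrow> (Neg \<phi>, c) \<in> formulas_over A n"
  unfolding formulas_over_def by simp

lemma holds_Neg: "holds R (Neg \<phi>, c) a \<longleftrightarrow> \<not> holds R (\<phi>, c) a"
  by (simp add: holds_def)

lemma stable_field_sets_definable_sets: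
  fixes R :: "'r \<Rightarrow> 'k::field list \<Rightarrow> bool"
  assumes "infinite (UNIV :: 'k set)" "stable_theory R"
  shows "stable_field_sets (definable_sets R)"
proof
  show "infinite (UNIV :: 'k set)" by fact
  have "{0} = {x. holds R (Eq (Var 0) Zero, []) [x]}" by (simp add: holds_def assign_def)
  also have "\<dots> \<in> definable_sets R" by (rule definable_setsI[of _ UNIV]) (simp add: formulas_over_def)
  finally show "{0} \<in> definable_sets R" .
next
  fix X assume "X \<in> definable_sets R"
  then obtain \<phi> c where \<phi>: "free_vars \<phi> \<subseteq> {..<1 + length c}" "X = {x. holds R (\<phi>, c) [x]}"
    by (rule definable_setsE)
  then have "- X = {x. holds R (Neg \<phi>, c) [x]}" by (auto simp: holds_Neg)
  then show "- X \<in> definable_sets R"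
    using \<phi>(1) definable_setsI[of "(Neg \<phi>, c)" UNIV] by (simp add: formulas_over_def)
next
  fix X Y assume "X \<in> definable_sets R" "Y \<in> definable_sets R"
  then obtain \<phi> c \<psi> d where \<phi>: "free_vars \<phi> \<subseteq> {..<1 + length c}" "X = {x. holds R (\<phi>, c) [x]}"
    and \<psi>: "free_vars \<psi> \<subseteq> {..<1 + length d}" "Y = {x. holds R (\<psi>, d) [x]}"
    by (metis definable_setsE)
  \<comment> \<open>Moves the parameters of \<open>\<psi>\<close> behind those of
    \<open>\<phi>\<close>, keeping the common variable 0.\<close>
  define \<tau> where "\<tau> i = Var (if i = 0 then 0 else i + length c)" for i
  obtain \<psi>' where \<psi>': "free_vars \<psi>' \<subseteq> (\<Union>i\<in>free_vars \<psi>. tm_vars (\<tau> i))"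
    "\<And>e. sat R e \<psi>' \<longleftrightarrow> sat R (\<lambda>i. tm_val e (\<tau> i)) \<psi>"
    using ex_subst[of \<tau> \<psi> R] by auto
  have fv: "free_vars (Conj \<phi> \<psi>') \<subseteq> {..<1 + length (c @ d)}"
    using \<phi>(1) \<psi>(1) \<psi>'(1) by (force simp: \<tau>_def split: if_splits)
  have "holds R (\<psi>', c @ d) [x] \<longleftrightarrow> holds R (\<psi>, d) [x]" for x
    unfolding holds_def fst_conv \<psi>'(2) using \<psi>(1)
    by (intro sat_cong) (auto simp: \<tau>_def assign_def nth_append nth_Cons')
  moreover have "holds R (\<phi>, c @ d) [x] \<longleftrightarrow> holds R (\<phi>, c) [x]" for x
    unfolding holds_def fst_conv using \<phi>(1)
    by (intro sat_cong) (auto simp: assign_def nth_append nth_Cons')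
  moreover have "holds R (Conj \<phi> \<psi>', c @ d) [x] \<longleftrightarrow> holds R (\<phi>, c @ d) [x] \<and> holds R (\<psi>', c @ d) [x]" for x
    by (simp add: holds_def)
  ultimately have "X \<inter> Y = {x. holds R (Conj \<phi> \<psi>', c @ d) [x]}" using \<phi>(2) \<psi>(2) by auto
  then show "X \<inter> Y \<in> definable_sets R"
    using fv definable_setsI[of "(Conj \<phi> \<psi>', c @ d)" UNIV] by (simp add: formulas_over_def)
next
  fix X and l h :: 'k assume "X \<in> definable_sets R"
  then obtain \<phi> c where \<phi>: "free_vars \<phi> \<subseteq> {..<1 + length c}" "X = {x. holds R (\<phi>, c) [x]}"
    by (rule definable_setsE)
  obtain \<phi>' where \<phi>': "free_vars \<phi>' \<subseteq> {..<1 + (length c + 2)}"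
    "\<And>x. holds R (\<phi>', c @ [l, h]) [x] \<longleftrightarrow> holds R (\<phi>, c) [l * x + h]"
    using ex_affine_formula[OF \<phi>(1)] by blast
  have "{x. l * x + h \<in> X} = {x. holds R (\<phi>', c @ [l, h]) [x]}" using \<phi>(2) \<phi>'(2) by simp
  then show "{x. l * x + h \<in> X} \<in> definable_sets R"
    using \<phi>'(1) definable_setsI[of "(\<phi>', c @ [l, h])" UNIV] by (simp add: formulas_over_def)
next
  fix X assume "X \<in> definable_sets R"
  then obtain \<phi> c where \<phi>: "free_vars \<phi> \<subseteq> {..<1 + length c}" "X = {x. holds R (\<phi>, c) [x]}"
    by (rule definable_setsE)
  obtain \<phi>' where \<phi>': "free_vars \<phi>' \<subseteq> {..<1 + (length c + 2)}"
    "\<And>x l h. holds R (\<phi>', c @ [l, h]) [x] \<longleftrightarrow> holds R (\<phi>, c) [l * x + h]"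
    using ex_affine_formula[OF \<phi>(1)] by blast
  \<comment> \<open>Stability is applied to \<open>\<phi>'\<close>, in which \<open>l\<close> and
    \<open>h\<close> are parameters; the tuple \<open>c\<close> is repeated in every column of the
    half-graph.\<close>
  obtain N where N: "\<not> (\<exists>a b. (\<forall>i<N. length (a i) = 1 \<and> length (b i) = length c + 2) \<and>
            (\<forall>i<N. \<forall>j<N. sat R (assign (a i @ b j)) \<phi>' \<longleftrightarrow> i < (j :: nat)))"
    using assms(2)[unfolded stable_theory_def, THEN spec, THEN spec, THEN spec, THEN mp, OF \<phi>'(1)]
    by (elim exE)
  have "\<not> (\<exists>x l h. \<forall>i<N. \<forall>j<N. l j * x i + h j \<in> X \<longleftrightarrow> i < (j :: nat))"
  proof
    assume "\<exists>x l h. \<forall>i<N. \<forall>j<N. l j * x i + h j \<in> X \<longleftrightarrow> i < (j :: nat)"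
    then obtain x l h where xlh: "\<forall>i<N. \<forall>j<N. l j * x i + h j \<in> X \<longleftrightarrow> i < (j :: nat)" by blast
    have "sat R (assign ([x i] @ c @ [l j, h j])) \<phi>' \<longleftrightarrow> l j * x i + h j \<in> X" for i j
      using \<phi>'(2)[of "l j" "h j" "x i"] \<phi>(2) by (simp add: holds_def)
    then show False
      using xlh N[unfolded not_ex, rule_format, of "\<lambda>i. [x i]" "\<lambda>j. c @ [l j, h j]"] by auto
  qed
  then show "\<exists>N. \<not> (\<exists>x l h. \<forall>i<N. \<forall>j<N. l j * x i + h j \<in> X \<longleftrightarrow> i < (j :: nat))" by blast
qed

section \<open>Definability of genericity in the parameters\<close>

primrec exists_block :: "nat \<Rightarrow> nat \<Rightarrow> 'r fm \<Rightarrow> 'r fm" where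
  "exists_block n 0 \<phi> = \<phi>"
| "exists_block n (Suc N) \<phi> = Exists n (exists_block (Suc n) N \<phi>)"

lemma free_vars_exists_block: "free_vars (exists_block n N \<phi>) = free_vars \<phi> - {n..<n + N}"
  by (induction N arbitrary: n) (auto simp: Suc_le_eq)

lemma sat_exists_block:
  "sat R e (exists_block n N \<phi>) \<longleftrightarrow> (\<exists>e'. (\<forall>i. i \<notin> {n..<n + N} \<longrightarrow> e' i = e i) \<and> sat R e' \<phi>)"
proof (induction N arbitrary: n e)
  case 0
  have "(\<forall>i. e' i = e i) \<longleftrightarrow> e' = e" for e' by auto
  then show ?case by simp
next
  case (Suc N)
  have *: "(\<forall>i. i \<notin> {Suc n..<Suc n + N} \<longrightarrow> e' i = (e(n := e' n)) i) \<longleftrightarrow> (\<forall>i. i \<notin> {n..<n + Suc N} \<longrightarrow> e' i = e i)"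
    for e' by (auto simp: Suc_le_eq)
  have "sat R e (exists_block n (Suc N) \<phi>) \<longleftrightarrow>
    (\<exists>x e'. (\<forall>i. i \<notin> {Suc n..<Suc n + N} \<longrightarrow> e' i = (e(n := x)) i) \<and> sat R e' \<phi>)"
    by (simp only: exists_block.simps sat.simps Suc.IH)
  also have "\<dots> \<longleftrightarrow> (\<exists>e'. (\<forall>i. i \<notin> {Suc n..<Suc n + N} \<longrightarrow> e' i = (e(n := e' n)) i) \<and> sat R e' \<phi>)"
  proof
    assume "\<exists>x e'. (\<forall>i. i \<notin> {Suc n..<Suc n + N} \<longrightarrow> e' i = (e(n := x)) i) \<and> sat R e' \<phi>"
    then obtain x e' where e': "\<forall>i. i \<notin> {Suc n..<Suc n + N} \<longrightarrow> e' i = (e(n := x)) i" "sat R e' \<phi>"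
      by blast
    moreover have "e' n = x" using e'(1)[rule_format, of n] by simp
    ultimately show "\<exists>e'. (\<forall>i. i \<notin> {Suc n..<Suc n + N} \<longrightarrow> e' i = (e(n := e' n)) i) \<and> sat R e' \<phi>"
      by (intro exI[of _ e']) simp
  qed (elim exE, intro exI)
  finally show ?case unfolding * .
qed

primrec conj_list :: "'r fm list \<Rightarrow> 'r fm" where
  "conj_list [] = Eq Zero Zero"
| "conj_list (\<phi> # l) = Conj \<phi> (conj_list l)"

lemma free_vars_conj_list: "free_vars (conj_list l) = (\<Union>\<phi>\<in>set l. free_vars \<phi>)"
  by (induction l) auto

lemma sat_conj_list: "sat R e (conj_list l) \<longleftrightarrow> (\<forall>\<phi>\<in>set l. sat R e \<phi>)"
  by (induction l) auto

text \<open>For a fixed number \<open>N\<close> of translates, covering the field is a first-order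
  condition on \<open>c\<close>: there are \<open>N\<close> elements such that every
  \<open>x\<close> lies in one of the translates by them.\<close>

lemma ex_covering_formula:
  fixes R :: "'r \<Rightarrow> 'k::field list \<Rightarrow> bool" and N :: nat
  assumes "free_vars \<phi> \<subseteq> {..<1 + n}"
  shows "\<exists>\<gamma>. free_vars \<gamma> \<subseteq> {..<n} \<and> (\<forall>c. length c = n \<longrightarrow>
    (sat R (assign c) \<gamma> \<longleftrightarrow> (\<exists>g. \<forall>x. \<exists>k<N. holds R (\<phi>, c) [x - g k])))"
proof -
  define M where "M = n + N"
  \<comment> \<open>The parameters \<open>c\<close> occupy the variables below \<open>n\<close>, the
    translating elements those from \<open>n\<close> to \<open>n + N - 1\<close>, and the covered
    element is variable \<open>M\<close>. In \<open>\<phi>\<close> itself the parameters start at 1,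
    hence the shift.\<close>
  define \<tau> where "\<tau> k i = (case i of 0 \<Rightarrow> Plus (Var M) (Minus (Var (n + k))) | Suc j \<Rightarrow> Var j)" for k i
  have "\<forall>k. \<exists>\<theta>. free_vars \<theta> \<subseteq> (\<Union>i\<in>free_vars \<phi>. tm_vars (\<tau> k i)) \<and>
    (\<forall>e. sat R e \<theta> \<longleftrightarrow> sat R (\<lambda>i. tm_val e (\<tau> k i)) \<phi>)" by (intro allI ex_subst)
  then obtain \<theta> where \<theta>: "\<And>k. free_vars (\<theta> k) \<subseteq> (\<Union>i\<in>free_vars \<phi>. tm_vars (\<tau> k i))"
    "\<And>k e. sat R e (\<theta> k) \<longleftrightarrow> sat R (\<lambda>i. tm_val e (\<tau> k i)) \<phi>" by metis
  define \<beta> where "\<beta> = Neg (Exists M (conj_list (map (\<lambda>k. Neg (\<theta> k)) [0..<N])))"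
  have "free_vars (\<theta> k) \<subseteq> {..<n} \<union> {n + k, M}" for k
    using \<theta>(1)[of k] assms by (force simp: \<tau>_def split: nat.splits)
  then have fv: "free_vars \<beta> \<subseteq> {..<M}"
    unfolding \<beta>_def by (fastforce simp: free_vars_conj_list M_def)
  have sat: "sat R e \<beta> \<longleftrightarrow> (\<forall>x. \<exists>k<N. holds R (\<phi>, c) [x - e (n + k)])"
    if e: "\<forall>i<n. e i = c ! i" "length c = n" for e c
  proof -
    have "sat R (e(M := x)) (\<theta> k) \<longleftrightarrow> holds R (\<phi>, c) [x - e (n + k)]" if "k < N" for x k
      unfolding \<theta>(2) holds_def fst_conv using assms e that
      by (intro sat_cong) (auto simp: \<tau>_def M_def assign_def nth_Cons' split: nat.splits dest!: subsetD)
    then show ?thesis unfolding \<beta>_def by (simp add: sat_conj_list Bex_def)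
  qed
  have "sat R (assign c) (exists_block n N \<beta>) \<longleftrightarrow> (\<exists>g. \<forall>x. \<exists>k<N. holds R (\<phi>, c) [x - g k])"
    if c: "length c = n" for c
  proof
    assume "sat R (assign c) (exists_block n N \<beta>)"
    then obtain e where e: "\<forall>i. i \<notin> {n..<n + N} \<longrightarrow> e i = assign c i" "sat R e \<beta>"
      unfolding sat_exists_block by blast
    have "\<forall>i<n. e i = c ! i" using e(1) c by (auto simp: assign_def)
    then show "\<exists>g. \<forall>x. \<exists>k<N. holds R (\<phi>, c) [x - g k]"
      using e(2) sat[OF _ c, of e] by (intro exI[of _ "\<lambda>k. e (n + k)"]) simp
  next
    assume "\<exists>g. \<forall>x. \<exists>k<N. holds R (\<phi>, c) [x - g k]"
    then obtain g where g: "\<forall>x. \<exists>k<N. holds R (\<phi>, c) [x - g k]" by blast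
    define e where "e i = (if i \<in> {n..<n + N} then g (i - n) else assign c i)" for i
    have "\<forall>i<n. e i = c ! i" using c by (auto simp: e_def assign_def)
    moreover have "e (n + k) = g k" if "k < N" for k using that by (simp add: e_def)
    then have "\<forall>x. \<exists>k<N. holds R (\<phi>, c) [x - e (n + k)]" using g by metis
    ultimately have "sat R e \<beta>" using sat[OF _ c, of e] by simp
    then show "sat R (assign c) (exists_block n N \<beta>)"
      unfolding sat_exists_block by (intro exI[of _ e]) (auto simp: e_def)
  qed
  moreover have "free_vars (exists_block n N \<beta>) \<subseteq> {..<n}"
    unfolding free_vars_exists_block using fv by (auto simp: M_def)
  ultimately show ?thesis by blast
qed

lemma generic_set_iff_indexed: "generic_set X \<longleftrightarrow> (\<exists>N g. \<forall>x. \<exists>k<(N::nat). x - g k \<in> X)"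
proof
  assume "generic_set X"
  then obtain G where G: "finite G" "\<forall>x. \<exists>g\<in>G. x - g \<in> X" unfolding generic_set_iff by blast
  obtain N and g :: "nat \<Rightarrow> 'a" where "G = g ` {i. i < N}" using G(1) finite_imp_nat_seg_image_inj_on by blast
  then show "\<exists>N g. \<forall>x. \<exists>k<(N::nat). x - g k \<in> X" using G(2) by blast
next
  assume "\<exists>N g. \<forall>x. \<exists>k<(N::nat). x - g k \<in> X"
  then obtain N g where "\<forall>x. \<exists>k<(N::nat). x - g k \<in> X" by blast
  then show "generic_set X" unfolding generic_set_iff by (intro exI[of _ "g ` {..<N}"]) auto
qed

text \<open>Genericity means that a covering formula holds of the parameters for some
  \<open>N\<close>, so it depends only on their type. The part \<open>e\<close> inside
  \<open>A\<close> is absorbed as parameters of that formula.\<close>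

lemma generic_set_tp_cong:
  assumes "tp R c A = tp R d A" "length c = length d" "set e \<subseteq> A"
    and "free_vars \<phi> \<subseteq> {..<1 + length (c @ e)}"
  shows "generic_set {x. holds R (\<phi>, c @ e) [x]} \<longleftrightarrow> generic_set {x. holds R (\<phi>, d @ e) [x]}"
proof -
  have "(\<exists>g. \<forall>x. \<exists>k<N. holds R (\<phi>, c @ e) [x - g k]) \<longleftrightarrow> (\<exists>g. \<forall>x. \<exists>k<N. holds R (\<phi>, d @ e) [x - g k])"
    for N :: nat
  proof -
    obtain \<gamma> where \<gamma>: "free_vars \<gamma> \<subseteq> {..<length (c @ e)}" "\<And>c'. length c' = length (c @ e) \<Longrightarrow>
      sat R (assign c') \<gamma> \<longleftrightarrow> (\<exists>g. \<forall>x. \<exists>k<N. holds R (\<phi>, c') [x - g k])"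
      using ex_covering_formula[OF assms(4), where R = R and N = N] by blast
    have "(\<gamma>, e) \<in> formulas_over A (length c)" "(\<gamma>, e) \<in> formulas_over A (length d)"
      using \<gamma>(1) assms(2,3) unfolding formulas_over_def by auto
    then have "holds R (\<gamma>, e) c \<longleftrightarrow> holds R (\<gamma>, e) d" using assms(1) unfolding tp_def by blast
    then show ?thesis using \<gamma>(2)[of "c @ e"] \<gamma>(2)[of "d @ e"] assms(2) by (simp add: holds_def)
  qed
  then show ?thesis unfolding generic_set_iff_indexed by simp
qed

section \<open>Roots and monomials\<close>

primrec tm_power :: "tm \<Rightarrow> nat \<Rightarrow> tm" where
  "tm_power t 0 = One"
| "tm_power t (Suc n) = Times t (tm_power t n)"

lemma tm_val_power: "tm_val e (tm_power t n) = tm_val e t ^ n"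
  by (induction n) auto

lemma tm_vars_power: "tm_vars (tm_power t n) \<subseteq> tm_vars t"
  by (induction n) auto

primrec tm_prod :: "(nat \<Rightarrow> tm) \<Rightarrow> nat \<Rightarrow> tm" where
  "tm_prod t 0 = One"
| "tm_prod t (Suc n) = Times (tm_prod t n) (t n)"

lemma tm_val_prod: "tm_val e (tm_prod t n) = (\<Prod>i<n. tm_val e (t i))"
  by (induction n) auto

lemma tm_vars_prod: "tm_vars (tm_prod t n) = (\<Union>i<n. tm_vars (t i))"
  by (induction n) (auto simp: lessThan_Suc)

lemma ex_monomial_formula:
  assumes "(\<phi>, c) \<in> formulas_over A 1"
  shows "\<exists>\<phi>'. (\<phi>', c) \<in> formulas_over A n \<and>
    (\<forall>x. length x = n \<longrightarrow> (holds R (\<phi>', c) x \<longleftrightarrow> holds R (\<phi>, c) [\<Prod>i<n. x ! i ^ f i]))"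
proof -
  define \<tau> where "\<tau> i = (case i of 0 \<Rightarrow> tm_prod (\<lambda>i. tm_power (Var i) (f i)) n | Suc j \<Rightarrow> Var (n + j))" for i
  obtain \<phi>' where \<phi>': "free_vars \<phi>' \<subseteq> (\<Union>i\<in>free_vars \<phi>. tm_vars (\<tau> i))"
    "\<And>e. sat R e \<phi>' \<longleftrightarrow> sat R (\<lambda>i. tm_val e (\<tau> i)) \<phi>"
    using ex_subst[of \<tau> \<phi> R] by auto
  have fv: "free_vars \<phi> \<subseteq> {..<1 + length c}" and "set c \<subseteq> A" using assms by (auto simp: formulas_over_def)
  have "tm_vars (\<tau> i) \<subseteq> {..<n + length c}" if "i \<in> free_vars \<phi>" for i
    using subsetD[OF fv that] tm_vars_power by (fastforce simp: \<tau>_def tm_vars_prod split: nat.splits)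
  then have "(\<phi>', c) \<in> formulas_over A n"
    using \<phi>'(1) \<open>set c \<subseteq> A\<close> unfolding formulas_over_def by blast
  moreover have "holds R (\<phi>', c) x \<longleftrightarrow> holds R (\<phi>, c) [\<Prod>i<n. x ! i ^ f i]" if "length x = n" for x
    unfolding holds_def fst_conv \<phi>'(2) using fv that
    by (intro sat_cong)
      (auto simp: \<tau>_def tm_val_prod tm_val_power assign_def nth_append split: nat.splits intro!: prod.cong)
  ultimately show ?thesis by blast
qed

text \<open>Multiplying \<open>x\<close> by \<open>z ^ q\<close> rather than \<open>b ^ f\<close> excludes \<open>x = 0\<close> as soon as \<open>b \<noteq> 0\<close>.\<close>

definition coset_fm :: "nat \<Rightarrow> nat \<Rightarrow> 'r fm" where
  "coset_fm q f = Exists 2 (Eq (Times (Var 0) (tm_power (Var 2) q)) (tm_power (Var 1) f))"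

lemma coset_fm_formulas_over: "b \<in> C \<Longrightarrow> (coset_fm q f, [b]) \<in> formulas_over C 1"
  using tm_vars_power[of "Var 1" f] tm_vars_power[of "Var 2" q]
  by (fastforce simp: formulas_over_def coset_fm_def)

lemma holds_coset_fm: "holds R (coset_fm q f, [b]) [x] \<longleftrightarrow> (\<exists>z. x * z ^ q = b ^ f)"
  by (simp add: holds_def coset_fm_def tm_val_power assign_def)

section \<open>Coprime exponents\<close>

lemma coprime_bezout_nat:
  assumes "coprime m (n :: nat)" "m \<noteq> 0"
  obtains x y where "m * x = n * y + 1"
  using bezout_add_strong_nat[OF assms(2), of n] assms(1) by (metis coprime_common_divisor_nat)

text \<open>The exponent \<open>f\<close> is invertible modulo \<open>q\<close>: if
  \<open>f * x = q * y + 1\<close>, then \<open>a\<close> is the quotient of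
  \<open>(a ^ f) ^ x\<close> by \<open>(a ^ y) ^ q\<close>, both of them \<open>q\<close>-th
  powers.\<close>

lemma coprime_power_eq_power:
  fixes a u :: "'k::field"
  assumes "a ^ f = u ^ q" "coprime f q" "f \<noteq> 0" "a \<noteq> 0"
  shows "\<exists>w. a = w ^ q"
proof -
  obtain x y where "f * x = q * y + 1" using coprime_bezout_nat[OF assms(2,3)] .
  then have "(u ^ q) ^ x = a ^ (q * y + 1)" by (metis assms(1) power_mult)
  then have "(u ^ x) ^ q = (a ^ y) ^ q * a" by (simp add: power_mult[symmetric] mult.commute)
  then have "a = (u ^ x / a ^ y) ^ q" using assms(4) by (simp add: power_divide field_simps)
  then show ?thesis by blast
qed

text \<open>A new number \<open>q n\<close> multiplies all old exponents and gets the exponent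
  \<open>Q\<close>, the product of the old numbers. With \<open>q n * x = Q * y + 1\<close>, the
  element \<open>t\<close> is \<open>(t ^ x) ^ q n\<close> times \<open>((1 / t) ^ y) ^ Q\<close>,
  and induction represents \<open>t ^ x\<close>. The factors are nonzero so that they can later
  rescale generic elements.\<close>

lemma ex_prod_powers:
  fixes t :: "'k::field" and q :: "nat \<Rightarrow> nat"
  assumes "t \<noteq> 0" "0 < n" "\<And>i j. i < n \<Longrightarrow> j < n \<Longrightarrow> i \<noteq> j \<Longrightarrow> coprime (q i) (q j)"
    and "\<And>i. i < n \<Longrightarrow> q i \<noteq> 0"
  shows "\<exists>s. (\<forall>i. s i \<noteq> 0) \<and> (\<Prod>i<n. s i ^ (\<Prod>k\<in>{..<n} - {i}. q k)) = t"
  using assms(2,1,3,4)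
proof (induction n arbitrary: t rule: nat_induct_non_zero)
  case 1
  then show ?case by (intro exI[of _ "\<lambda>_. t"]) (simp add: lessThan_Suc)
next
  case (Suc n)
  define Q where "Q = (\<Prod>k<n. q k)"
  have "coprime (q n) Q" unfolding Q_def using Suc.prems(2) by (intro prod_coprime_right) auto
  then obtain x y where xy: "q n * x = Q * y + 1"
    using coprime_bezout_nat Suc.prems(3)[of n] by blast
  obtain s where s: "\<And>i. s i \<noteq> 0" "(\<Prod>i<n. s i ^ (\<Prod>k\<in>{..<n} - {i}. q k)) = t ^ x"
    using Suc.IH[of "t ^ x"] Suc.prems by auto
  define s' where "s' = s(n := (1 / t) ^ y)"
  have "(\<Prod>k\<in>{..<Suc n} - {i}. q k) = (\<Prod>k\<in>{..<n} - {i}. q k) * q n" if "i < n" for i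
  proof -
    have "{..<Suc n} - {i} = insert n ({..<n} - {i})" using that by auto
    then show ?thesis by (simp add: mult.commute)
  qed
  then have "(\<Prod>i<n. s' i ^ (\<Prod>k\<in>{..<Suc n} - {i}. q k)) = (\<Prod>i<n. (s i ^ (\<Prod>k\<in>{..<n} - {i}. q k)) ^ q n)"
    by (intro prod.cong) (auto simp: s'_def power_mult)
  also have "\<dots> = (t ^ x) ^ q n" unfolding prod_power_distrib[symmetric] s(2) ..
  also have "\<dots> = t ^ (q n * x)" by (simp add: power_mult[symmetric] mult.commute)
  also have "\<dots> = t ^ (Q * y) * t" by (simp add: xy)
  finally have 1: "(\<Prod>i<n. s' i ^ (\<Prod>k\<in>{..<Suc n} - {i}. q k)) = t ^ (Q * y) * t" .
  have "{..<Suc n} - {n} = {..<n}" by auto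
  then have "s' n ^ (\<Prod>k\<in>{..<Suc n} - {n}. q k) = (1 / t) ^ (Q * y)"
    by (simp add: s'_def Q_def power_mult[symmetric] mult.commute)
  then have "(\<Prod>i<Suc n. s' i ^ (\<Prod>k\<in>{..<Suc n} - {i}. q k)) = t"
    using 1 Suc.prems(1) by (simp add: power_divide)
  moreover have "\<forall>i. s' i \<noteq> 0" using s(1) Suc.prems(1) by (simp add: s'_def)
  ultimately show ?case by blast
qed

section \<open>Generic elements\<close>

lemma infinite_UNIV_fm: "infinite (UNIV :: 'r fm set)"
proof -
  have "inj (\<lambda>n. Eq (Var n) Zero :: 'r fm)" by (simp add: inj_def)
  then show ?thesis using finite_subset[OF subset_UNIV] finite_imageD infinite_UNIV_nat by blast
qed

text \<open>The cardinal \<open>\<kappa>\<close> exceeds the infinite number of formulas, so it is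
  infinite.\<close>

lemma small_Un_finite:
  fixes R :: "'r \<Rightarrow> 'k::field list \<Rightarrow> bool"
  assumes "monster \<kappa> R" "small \<kappa> A" "finite T"
  shows "small \<kappa> (A \<union> T)"
proof -
  have \<kappa>: "Card_order \<kappa>" "|UNIV :: 'r fm set| <o \<kappa>" using assms(1) unfolding monster_def by auto
  have "|UNIV :: 'r fm set| \<le>o |Field \<kappa>|"
    using \<kappa> by (meson card_of_Field_ordIso ordIso_symmetric ordLess_imp_ordLeq ordLeq_ordIso_trans)
  then have inf: "infinite (Field \<kappa>)" using card_of_ordLeq_finite infinite_UNIV_fm by blast
  have "|T| <o \<kappa>"
    using finite_ordLess_infinite[OF card_of_Well_order _ _ inf] card_order_on_well_order_on[OF \<kappa>(1)] assms(3)
    by (simp add: Field_card_of)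
  then show ?thesis using card_of_Un_ordLess_infinite_Field[OF inf \<kappa>(1)] assms(2) unfolding small_def by blast
qed

text \<open>That is, \<open>x\<close> realises the generic type over \<open>C\<close>.\<close>

definition generic_over :: "('r \<Rightarrow> 'k::field list \<Rightarrow> bool) \<Rightarrow> 'k set \<Rightarrow> 'k \<Rightarrow> bool" where
  "generic_over R C x \<longleftrightarrow> (\<forall>\<psi>\<in>formulas_over C 1. holds R \<psi> [x] \<longrightarrow> generic_set {y. holds R \<psi> [y]})"

lemma generic_over_mono: "generic_over R C x \<Longrightarrow> C' \<subseteq> C \<Longrightarrow> generic_over R C' x"
  unfolding generic_over_def formulas_over_def by blast

lemma generic_over_affine:
  assumes "generic_over R C x" "l \<in> C" "h \<in> C" "l \<noteq> 0"
  shows "generic_over R C (l * x + h)"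
  unfolding generic_over_def
proof (intro ballI impI)
  fix \<psi> :: "('a, 'b) pfm"
  assume \<psi>: "\<psi> \<in> formulas_over C 1" "holds R \<psi> [l * x + h]"
  obtain \<phi> c where [simp]: "\<psi> = (\<phi>, c)" by (cases \<psi>)
  have fv: "free_vars \<phi> \<subseteq> {..<1 + length c}" and c: "set c \<subseteq> C" using \<psi>(1) by (auto simp: formulas_over_def)
  obtain \<phi>' where \<phi>': "free_vars \<phi>' \<subseteq> {..<1 + (length c + 2)}"
    "\<And>x. holds R (\<phi>', c @ [l, h]) [x] \<longleftrightarrow> holds R (\<phi>, c) [l * x + h]"
    using ex_affine_formula[OF fv] by blast
  have "(\<phi>', c @ [l, h]) \<in> formulas_over C 1" using \<phi>'(1) c assms(2,3) by (simp add: formulas_over_def)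
  moreover have "holds R (\<phi>', c @ [l, h]) [x]" using \<psi>(2) \<phi>'(2) by simp
  ultimately have "generic_set {y. holds R (\<phi>', c @ [l, h]) [y]}"
    by (rule assms(1)[unfolded generic_over_def, rule_format])
  then have "generic_set {y. l * y + h \<in> {y. holds R \<psi> [y]}}" using \<phi>'(2) by simp
  then show "generic_set {y. holds R \<psi> [y]}" using generic_set_affine_iff[OF assms(4)] by blast
qed

locale stable_monster_field =
  fixes \<kappa> :: "'i rel" and R :: "'r \<Rightarrow> 'k::field list \<Rightarrow> bool"
  assumes infinite_UNIV: "infinite (UNIV :: 'k set)"
    and monster: "monster \<kappa> R"
    and stable: "stable_theory R"
begin

sublocale stable_field_sets "definable_sets R"
  using infinite_UNIV stable by (rule stable_field_sets_definable_sets)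

section \<open>The generic type and its realisations\<close>

lemma generic_set_Neg:
  assumes "(\<phi>, c) \<in> formulas_over C 1"
  shows "generic_set {x. holds R (Neg \<phi>, c) [x]} \<longleftrightarrow> \<not> generic_set {x. holds R (\<phi>, c) [x]}"
proof -
  have "{x. holds R (Neg \<phi>, c) [x]} = - {x. holds R (\<phi>, c) [x]}" by (auto simp: holds_Neg)
  then show ?thesis using generic_Compl_iff[OF definable_setsI[OF assms]] by simp
qed

text \<open>If \<open>\<psi>\<close> fails at \<open>x\<close>, its negation holds there and is
  generic, so \<open>\<psi>\<close> is not. Hence all elements generic over \<open>C\<close> have
  the same type over \<open>C\<close>.\<close>

lemma generic_over_iff:
  assumes "generic_over R C x" "\<psi> \<in> formulas_over C 1"
  shows "holds R \<psi> [x] \<longleftrightarrow> generic_set {y. holds R \<psi> [y]}"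
proof -
  obtain \<phi> c where [simp]: "\<psi> = (\<phi>, c)" by (cases \<psi>)
  have "(Neg \<phi>, c) \<in> formulas_over C 1" using assms(2) Neg_formulas_over by simp
  then have "\<not> holds R \<psi> [x] \<longrightarrow> \<not> generic_set {y. holds R \<psi> [y]}"
    using assms(1) generic_set_Neg[of \<phi> c C] assms(2) unfolding generic_over_def by (auto simp: holds_Neg)
  then show ?thesis using assms unfolding generic_over_def by blast
qed

lemma tp_generic_over:
  "generic_over R C x \<Longrightarrow> tp R [x] C = {\<psi> \<in> formulas_over C 1. generic_set {y. holds R \<psi> [y]}}"
  unfolding tp_def using generic_over_iff by auto

lemma generic_over_nonzero:
  assumes "generic_over R C x"
  shows "x \<noteq> 0"
proof
  assume "x = 0"
  then have "holds R (Eq (Var 0) Zero, []) [x]" by (simp add: holds_def assign_def)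
  moreover have "(Eq (Var 0) Zero, []) \<in> formulas_over C 1" by (simp add: formulas_over_def)
  ultimately have "generic_set {z. holds R (Eq (Var 0) Zero, []) [z]}"
    using assms unfolding generic_over_def by blast
  then show False using not_generic_singleton[OF infinite_UNIV] by (simp add: holds_def assign_def)
qed

text \<open>Uniqueness of the generic type: \<open>p\<close> contains each generic formula or its
  negation, and the negation is not generic.\<close>

lemma generic_type_eq:
  assumes "generic_type R C p"
  shows "p = {\<psi> \<in> formulas_over C 1. generic_set {y. holds R \<psi> [y]}}"
proof -
  have p: "p \<subseteq> formulas_over C 1" "\<forall>\<psi>\<in>p. generic_set {y. holds R \<psi> [y]}"
    "\<forall>\<phi> c. (\<phi>, c) \<in> formulas_over C 1 \<longrightarrow> (\<phi>, c) \<in> p \<or> (Neg \<phi>, c) \<in> p"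
    using assms unfolding generic_type_def complete_type_def by simp_all
  have "(\<phi>, c) \<in> p"
    if *: "(\<phi>, c) \<in> formulas_over C 1" "generic_set {y. holds R (\<phi>, c) [y]}" for \<phi> c
  proof -
    have "(Neg \<phi>, c) \<notin> p" using bspec[OF p(2), of "(Neg \<phi>, c)"] generic_set_Neg[OF *(1)] *(2) by auto
    then show ?thesis using p(3) *(1) by metis
  qed
  then show ?thesis using p(1,2) by auto
qed

lemma generic_set_finite_formulas:
  assumes "finite F" "F \<subseteq> {\<psi> \<in> formulas_over C 1. generic_set {y. holds R \<psi> [y]}}"
  shows "generic_set {x. \<forall>\<psi>\<in>F. holds R \<psi> [x]}"
proof -
  let ?F = "(\<lambda>\<psi>. {y. holds R \<psi> [y]}) ` F"
  have "?F \<subseteq> definable_sets R" using assms(2) definable_setsI[of _ C R] by blast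
  moreover have "\<forall>X\<in>?F. generic_set X" using assms(2) by auto
  ultimately have "generic_set (\<Inter>?F)" using generic_Inter[of ?F] assms(1) by simp
  moreover have "\<Inter>?F = {x. \<forall>\<psi>\<in>F. holds R \<psi> [x]}" by auto
  ultimately show ?thesis by simp
qed

text \<open>Generic definable sets form an ultrafilter, so the generic formulas over
  \<open>C\<close> are a complete type, which saturation realises.\<close>

lemma ex_generic_over:
  assumes "small \<kappa> C"
  shows "\<exists>x. generic_over R C x"
proof -
  define p where "p = {\<psi> \<in> formulas_over C 1. generic_set {y. holds R \<psi> [y]}}"
  have "complete_type R C 1 p"
    unfolding complete_type_def
  proof (intro conjI allI impI)
    show "p \<subseteq> formulas_over C 1" unfolding p_def by blast
  next
    fix F assume F: "F \<subseteq> p" "finite F"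
    have "{x. \<forall>\<psi>\<in>F. holds R \<psi> [x]} \<noteq> {}"
      by (rule generic_nonempty[OF generic_set_finite_formulas]) (use F in \<open>simp_all add: p_def\<close>)
    then obtain x where "\<forall>\<psi>\<in>F. holds R \<psi> [x]" by auto
    then show "\<exists>a. length a = 1 \<and> (\<forall>\<psi>\<in>F. holds R \<psi> a)" by (intro exI[of _ "[x]"]) simp
  next
    fix \<phi> :: "'r fm" and c :: "'k list" assume *: "(\<phi>, c) \<in> formulas_over C 1"
    show "(\<phi>, c) \<in> p \<or> (Neg \<phi>, c) \<in> p"
      using * Neg_formulas_over[OF *] generic_set_Neg[OF *] unfolding p_def by blast
  qed
  then obtain a where a: "length a = 1" "\<forall>\<psi>\<in>p. holds R \<psi> a"
    using monster assms unfolding monster_def by blast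
  obtain x where [simp]: "a = [x]" using a(1) by (cases a) auto
  have "generic_over R C x"
    unfolding generic_over_def
  proof safe
    fix \<phi> :: "'r fm" and c :: "'k list"
    assume *: "(\<phi>, c) \<in> formulas_over C 1" "holds R (\<phi>, c) [x]"
    then have "(Neg \<phi>, c) \<notin> p" using a(2) by (auto simp: holds_Neg)
    then show "generic_set {y. holds R (\<phi>, c) [y]}"
      using Neg_formulas_over[OF *(1)] generic_set_Neg[OF *(1)] unfolding p_def by blast
  qed
  then show ?thesis by blast
qed

section \<open>Genericity and forking\<close>

text \<open>Conjugates over \<open>A\<close> of a generic formula are generic, and any finitely many
  generic definable sets meet, so no infinite sequence of conjugates is
  \<open>k\<close>-inconsistent.\<close>

lemma divides_not_generic:
  assumes "divides R 1 A \<psi>" "\<psi> \<in> formulas_over UNIV 1"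
  shows "\<not> generic_set {x. holds R \<psi> [x]}"
proof
  assume gen: "generic_set {x. holds R \<psi> [x]}"
  obtain \<phi> c where [simp]: "\<psi> = (\<phi>, c)" by (cases \<psi>)
  have fv: "free_vars \<phi> \<subseteq> {..<1 + length c}" using assms(2) by (simp add: formulas_over_def)
  obtain k and b :: "nat \<Rightarrow> 'k list" where "\<forall>i. length (b i) = length c \<and> tp R (b i) A = tp R c A"
    and k: "\<forall>I. finite I \<and> card I = k \<longrightarrow> \<not> (\<exists>a. length a = 1 \<and> (\<forall>i\<in>I. holds R (\<phi>, b i) a))"
    using assms(1) unfolding divides_def \<open>\<psi> = (\<phi>, c)\<close> fst_conv snd_conv by (elim exE conjE)
  then have b: "length (b i) = length c" "tp R (b i) A = tp R c A" for i by simp_all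
  let ?F = "(\<lambda>i. {x. holds R (\<phi>, b i) [x]}) ` {..<k}"
  have "generic_set {x. holds R (\<phi>, b i) [x]}" for i
    using generic_set_tp_cong[of R "b i" A c "[]" \<phi>] b fv gen by simp
  moreover have "{x. holds R (\<phi>, b i) [x]} \<in> definable_sets R" for i
    by (rule definable_setsI[of _ UNIV]) (use fv b(1) in \<open>simp add: formulas_over_def\<close>)
  ultimately have "generic_set (\<Inter>?F)" using generic_Inter[of ?F] by auto
  then have "\<Inter>?F \<noteq> {}" by (rule generic_nonempty)
  then obtain x where "x \<in> \<Inter>?F" by auto
  then have "length [x] = 1 \<and> (\<forall>i\<in>{..<k}. holds R (\<phi>, b i) [x])" by simp
  moreover have "finite {..<k} \<and> card {..<k} = k" by simp
  ultimately show False using k by metis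
qed

text \<open>A finite conjunction of generic formulas is generic. Were it covered by finitely many
  dividing formulas, one of these would be generic.\<close>

lemma generic_over_not_forks:
  assumes "generic_over R C x"
  shows "\<not> forks R 1 A (tp R [x] C)"
proof
  assume "forks R 1 A (tp R [x] C)"
  then obtain D F where D: "finite D" "D \<subseteq> formulas_over UNIV 1" "\<forall>\<psi>\<in>D. divides R 1 A \<psi>"
    and F: "finite F" "F \<subseteq> tp R [x] C"
    and imp: "\<forall>a. length a = 1 \<and> (\<forall>\<psi>\<in>F. holds R \<psi> a) \<longrightarrow> (\<exists>\<psi>\<in>D. holds R \<psi> a)"
    unfolding forks_def by (elim exE conjE)
  let ?S = "\<lambda>\<psi>. {y. holds R \<psi> [y]}"
  have "generic_set {x. \<forall>\<psi>\<in>F. holds R \<psi> [x]}"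
    by (rule generic_set_finite_formulas) (use F in \<open>simp_all add: tp_generic_over[OF assms]\<close>)
  moreover have "{x. \<forall>\<psi>\<in>F. holds R \<psi> [x]} \<subseteq> \<Union>(?S ` D)"
  proof
    fix x assume "x \<in> {x. \<forall>\<psi>\<in>F. holds R \<psi> [x]}"
    then show "x \<in> \<Union>(?S ` D)" using imp[rule_format, of "[x]"] by simp
  qed
  ultimately have "generic_set (\<Union>(?S ` D))" by (rule generic_set_mono)
  moreover have "?S ` D \<subseteq> definable_sets R" using D(2) definable_setsI[of _ UNIV R] by blast
  ultimately obtain \<psi> where "\<psi> \<in> D" "generic_set (?S \<psi>)" using generic_Union[of "?S ` D"] D(1) by auto
  then show False using divides_not_generic D(2,3) by blast
qed

section \<open>Sequences of independent generics\<close>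

text \<open>Each term is generic over all multiples of its predecessors by elements of
  \<open>T\<close>, so that the terms may be rescaled from \<open>T\<close> afterwards without
  losing independence.\<close>

lemma ex_generic_sequence:
  assumes "small \<kappa> A" "finite T"
  shows "\<exists>y. \<forall>i::nat. generic_over R (A \<union> T \<union> (\<lambda>(t, j). t * y j) ` (T \<times> {..<i})) (y i)"
proof -
  have "\<exists>y. \<forall>i::nat. generic_over R (A \<union> (T \<union> (\<lambda>(t, j). t * y j) ` (T \<times> {..<i}))) (y i)"
  proof (rule dependent_wellorder_choice[where
        P = "\<lambda>y i. generic_over R (A \<union> (T \<union> (\<lambda>(t, j). t * y j) ` (T \<times> {..<i})))"])
    fix i and y :: "nat \<Rightarrow> 'k"
    have "finite (T \<union> (\<lambda>(t, j). t * y j) ` (T \<times> {..<i}))" using assms(2) by simp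
    then show "\<exists>x. generic_over R (A \<union> (T \<union> (\<lambda>(t, j). t * y j) ` (T \<times> {..<i}))) x"
      by (intro ex_generic_over small_Un_finite[OF monster assms(1)])
  next
    fix y z :: "nat \<Rightarrow> 'k" and i x
    assume "\<And>j. j < i \<Longrightarrow> y j = z j"
    then have "(\<lambda>(t, j). t * y j) ` (T \<times> {..<i}) = (\<lambda>(t, j). t * z j) ` (T \<times> {..<i})"
      by (intro image_cong) auto
    then show "generic_over R (A \<union> (T \<union> (\<lambda>(t, j). t * y j) ` (T \<times> {..<i}))) x =
      generic_over R (A \<union> (T \<union> (\<lambda>(t, j). t * z j) ` (T \<times> {..<i}))) x" by simp
  qed
  then show ?thesis by (simp add: Un_assoc)
qed

lemma ex_generic_sequence_simple:
  assumes "small \<kappa> A"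
  shows "\<exists>y. \<forall>i::nat. generic_over R (A \<union> y ` {..<i}) (y i)"
proof -
  obtain y where y: "\<And>i::nat. generic_over R (A \<union> {1} \<union> (\<lambda>(t, j). t * y j) ` ({1} \<times> {..<i})) (y i)"
    using ex_generic_sequence[OF assms, of "{1}"] by auto
  have "generic_over R (A \<union> y ` {..<i}) (y i)" for i
    by (rule generic_over_mono[OF y[of i]]) force
  then show ?thesis by blast
qed

text \<open>Whether a formula holds at \<open>x # L\<close> with \<open>x\<close> generic over
  \<open>A\<close> and \<open>L\<close> amounts to genericity of its instance at \<open>L\<close>,
  which the type of \<open>L\<close> over \<open>A\<close> determines. Reversing the lists puts the
  latest term at variable 0, the place of the point in one-variable formulas.\<close>

lemma tp_generic_sequence:
  fixes n :: nat
  assumes "\<And>i. i < n \<Longrightarrow> generic_over R (A \<union> b ` {..<i}) (b i)"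
    and "\<And>i. i < n \<Longrightarrow> generic_over R (A \<union> b' ` {..<i}) (b' i)"
  shows "tp R (rev (map b [0..<n])) A = tp R (rev (map b' [0..<n])) A"
  using assms
proof (induction n)
  case 0
  then show ?case by simp
next
  case (Suc n)
  let ?L = "rev (map b [0..<n])" and ?L' = "rev (map b' [0..<n])"
  have IH: "tp R ?L A = tp R ?L' A" using Suc by simp
  have step: "holds R (\<phi>, e) (x # L) \<longleftrightarrow> generic_set {y. holds R (\<phi>, L @ e) [y]}"
    if "generic_over R (A \<union> set L) x" "(\<phi>, e) \<in> formulas_over A (Suc (length L))" for \<phi> e x L
  proof -
    have "(\<phi>, L @ e) \<in> formulas_over (A \<union> set L) 1" using that(2) by (auto simp: formulas_over_def)
    from generic_over_iff[OF that(1) this] show ?thesis by (simp add: holds_def)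
  qed
  have set: "set ?L = b ` {..<n}" "set ?L' = b' ` {..<n}" by auto
  have "holds R (\<phi>, e) (b n # ?L) \<longleftrightarrow> holds R (\<phi>, e) (b' n # ?L')"
    if \<phi>: "(\<phi>, e) \<in> formulas_over A (Suc n)" for \<phi> e
  proof -
    have "generic_set {y. holds R (\<phi>, ?L @ e) [y]} \<longleftrightarrow> generic_set {y. holds R (\<phi>, ?L' @ e) [y]}"
      by (rule generic_set_tp_cong[OF IH]) (use \<phi> in \<open>auto simp: formulas_over_def\<close>)
    then show ?thesis
      using step[of ?L "b n" \<phi> e] step[of ?L' "b' n" \<phi> e] Suc.prems(1,2)[of n] \<phi> unfolding set by simp
  qed
  then show ?case unfolding tp_def by auto
qed

text \<open>If the product avoided a generic set over \<open>A\<close>, then, as finitely many multiplicative translates of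
  that set cover the nonzero elements, suitable multiples of another sequence of independent generics
  would have their product in it; but all sequences of independent generics have the same type.\<close>

lemma generic_over_prod_powers:
  fixes n :: nat
  assumes "small \<kappa> A" "\<And>i. i < n \<Longrightarrow> generic_over R (A \<union> b ` {..<i}) (b i)"
    and roots: "\<And>t :: 'k. t \<noteq> 0 \<Longrightarrow> \<exists>s. (\<forall>i. s i \<noteq> 0) \<and> (\<Prod>i<n. s i ^ f i) = t"
  shows "generic_over R A (\<Prod>i<n. b i ^ f i)"
proof (rule ccontr)
  assume "\<not> ?thesis"
  then obtain \<phi> c where \<phi>: "(\<phi>, c) \<in> formulas_over A 1" "holds R (\<phi>, c) [\<Prod>i<n. b i ^ f i]"
    "\<not> generic_set {y. holds R (\<phi>, c) [y]}"
    unfolding generic_over_def by auto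
  let ?X = "{y. holds R (\<phi>, c) [y]}"
  have "generic_set (- ?X)" using generic_Compl_iff[OF definable_setsI[OF \<phi>(1)]] \<phi>(3) by blast
  then obtain T where T: "finite T" "0 \<notin> T" "\<And>x. x \<noteq> 0 \<Longrightarrow> \<exists>t\<in>T. t * x \<notin> ?X"
    using generic_multiplicative[OF Compl_D[OF definable_setsI[OF \<phi>(1)]]] by auto
  define s where "s t = (SOME s. (\<forall>i. s i \<noteq> 0) \<and> (\<Prod>i<n. s i ^ f i) = t)" for t :: 'k
  have s: "(\<forall>i. s t i \<noteq> 0) \<and> (\<Prod>i<n. s t i ^ f i) = t" if "t \<noteq> 0" for t :: 'k
    unfolding s_def using roots[OF that] by (rule someI_ex)
  \<comment> \<open>The element \<open>0\<close> is included because
    \<open>generic_over_affine\<close> asks for both coefficients in the base, and the rescaling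
    \<open>s t i * y i\<close> has constant term \<open>0\<close>.\<close>
  define T' where "T' = insert 0 ((\<lambda>(t, i). s t i) ` (T \<times> {..<n}))"
  have "finite T'" unfolding T'_def using T(1) by simp
  then obtain y where y: "\<And>i::nat. generic_over R (A \<union> T' \<union> (\<lambda>(t, j). t * y j) ` (T' \<times> {..<i})) (y i)"
    using ex_generic_sequence[OF assms(1)] by blast
  have y0: "y i \<noteq> 0" for i using y by (rule generic_over_nonzero)
  have "(\<Prod>i<n. y i ^ f i) \<noteq> 0" using y0 by simp
  then obtain t where t: "t \<in> T" "t * (\<Prod>i<n. y i ^ f i) \<notin> ?X" using T(3) by blast
  have t0: "t \<noteq> 0" using t(1) T(2) by metis
  \<comment> \<open>The monomial takes \<open>s t\<close> to \<open>t\<close>, so its value at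
    \<open>b'\<close> is \<open>t\<close> times its value at \<open>y\<close>. This lies outside
    \<open>?X\<close>, whereas the value at \<open>b\<close> lies inside.\<close>
  define b' where "b' i = s t i * y i" for i
  have "generic_over R (A \<union> b' ` {..<i}) (b' i)" if "i < n" for i
  proof -
    have mem: "s t j \<in> T'" if "j < n" for j unfolding T'_def using t(1) that by force
    have gen: "generic_over R (A \<union> T' \<union> (\<lambda>(t, j). t * y j) ` (T' \<times> {..<i})) (s t i * y i + 0)"
      by (rule generic_over_affine[OF y]) (use mem[OF \<open>i < n\<close>] s[OF t0] in \<open>auto simp: T'_def\<close>)
    have sub: "b' ` {..<i} \<subseteq> (\<lambda>(t, j). t * y j) ` (T' \<times> {..<i})"
      unfolding b'_def using mem \<open>i < n\<close> by force
    have "generic_over R (A \<union> b' ` {..<i}) (s t i * y i + 0)"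
      by (rule generic_over_mono[OF gen]) (use sub in blast)
    then show ?thesis by (simp add: b'_def[of i])
  qed
  then have tp: "tp R (rev (map b [0..<n])) A = tp R (rev (map b' [0..<n])) A"
    using tp_generic_sequence assms(2) by blast
  \<comment> \<open>The exponents are reversed because the sequence enters the type latest term
    first.\<close>
  obtain \<phi>' where \<phi>': "(\<phi>', c) \<in> formulas_over A n" "\<And>x. length x = n \<Longrightarrow>
      holds R (\<phi>', c) x \<longleftrightarrow> holds R (\<phi>, c) [\<Prod>i<n. x ! i ^ f (n - Suc i)]"
    using ex_monomial_formula[OF \<phi>(1), of n R "\<lambda>i. f (n - Suc i)"] by blast
  have prod: "holds R (\<phi>', c) (rev (map d [0..<n])) \<longleftrightarrow> (\<Prod>i<n. d i ^ f i) \<in> ?X" for d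
  proof -
    have "(\<Prod>i<n. rev (map d [0..<n]) ! i ^ f (n - Suc i)) = (\<Prod>i<n. d (n - Suc i) ^ f (n - Suc i))"
      by (intro prod.cong) (auto simp: rev_nth)
    also have "\<dots> = (\<Prod>i<n. d i ^ f i)" by (rule prod.nat_diff_reindex)
    finally show ?thesis using \<phi>'(2)[of "rev (map d [0..<n])"] by simp
  qed
  have "(\<Prod>i<n. b i ^ f i) \<in> ?X \<longleftrightarrow> (\<Prod>i<n. b' i ^ f i) \<in> ?X"
    using tp \<phi>'(1) unfolding prod[symmetric] tp_def by auto
  moreover have "(\<Prod>i<n. b' i ^ f i) = t * (\<Prod>i<n. y i ^ f i)"
    unfolding b'_def power_mult_distrib prod.distrib using s[OF t0] by simp
  ultimately show False using \<phi>(2) t(2) by simp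
qed

section \<open>Cosets of powers and the weight\<close>

text \<open>The set is the coset of \<open>c\<close> modulo nonzero \<open>q\<close>-th powers. If
  \<open>t\<close> is not a \<open>q\<close>-th power, the coset is disjoint from its preimage under
  multiplication by \<open>t\<close>; but that preimage of a generic set would be generic, and two
  generic definable sets meet.\<close>

lemma coset_not_generic:
  fixes c :: 'k
  assumes "{x ^ q | x :: 'k. True} \<noteq> UNIV" "0 < q" "c \<noteq> 0"
  shows "\<not> generic_set {y. \<exists>z. y * z ^ q = c}"
proof
  let ?S = "{y. \<exists>z. y * z ^ q = c}"
  assume gen: "generic_set ?S"
  obtain t :: 'k where t: "\<And>x. t \<noteq> x ^ q" using assms(1) by blast
  have "t \<noteq> 0" using t[of 0] assms(2) by (simp add: power_0_left)
  have "?S \<in> definable_sets R"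
    using definable_setsI[OF coset_fm_formulas_over[of c UNIV q 1], of R] by (simp add: holds_coset_fm)
  moreover have "generic_set {y. t * y + 0 \<in> ?S}" using generic_set_affine[OF gen \<open>t \<noteq> 0\<close>] .
  ultimately have "generic_set (?S \<inter> {y. t * y + 0 \<in> ?S})" using generic_Int[OF _ affine_D] gen by blast
  then have "?S \<inter> {y. t * y + 0 \<in> ?S} \<noteq> {}" by (rule generic_nonempty)
  then obtain y z z' where yz: "y * z ^ q = c" "t * y * z' ^ q = c" by auto
  have nz: "y \<noteq> 0" "z' ^ q \<noteq> 0" using yz assms(3) by (metis mult_eq_0_iff)+
  have "y * (t * z' ^ q) = y * z ^ q" using yz by (simp add: mult_ac)
  then have "t * z' ^ q = z ^ q" using nz(1) by simp
  then have "t = (z / z') ^ q" unfolding power_divide using nz(2) by (simp add: eq_divide_eq)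
  then show False using t by blast
qed

text \<open>The conjugates are taken along a sequence of independent generics \<open>c i\<close>. A
  common solution of two of them makes \<open>(c i / c j) ^ f\<close>, hence
  \<open>c i / c j\<close>, a \<open>q\<close>-th power, so \<open>c j\<close> would lie in a
  nongeneric coset defined over an earlier term. The sequence is thus 2-inconsistent.\<close>

lemma coset_fm_divides:
  assumes "small \<kappa> A" "generic_over R A b" "{x ^ q | x :: 'k. True} \<noteq> UNIV" "0 < q" "coprime f q" "f \<noteq> 0"
  shows "divides R 1 A (coset_fm q f, [b])"
proof -
  obtain c where c: "\<And>i::nat. generic_over R (A \<union> c ` {..<i}) (c i)"
    using ex_generic_sequence_simple[OF assms(1)] by blast
  have cA: "generic_over R A (c i)" for i using c by (rule generic_over_mono) simp
  have c0: "c i \<noteq> 0" for i using c by (rule generic_over_nonzero)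
  have no_common: "\<not> (\<exists>z. x * z ^ q = c i ^ f) \<or> \<not> (\<exists>z. x * z ^ q = c j ^ f)" if "i < j" for i j x
  proof (rule ccontr)
    assume "\<not> ?thesis"
    then obtain z z' where z: "x * z ^ q = c i ^ f" "x * z' ^ q = c j ^ f" by blast
    have nz: "x \<noteq> 0" "z ^ q \<noteq> 0" "z' ^ q \<noteq> 0" using z c0[of i] c0[of j] by (metis mult_eq_0_iff power_not_zero)+
    have "(c i / c j) ^ f = (z / z') ^ q" unfolding power_divide z[symmetric] using nz by simp
    then obtain w where "c i / c j = w ^ q" using coprime_power_eq_power assms(5,6) c0 by (metis divide_eq_0_iff)
    \<comment> \<open>With exponent 1 the formula places \<open>c j\<close> in the coset of
      \<open>c i\<close> itself.\<close>
    then have "holds R (coset_fm q 1, [c i]) [c j]"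
      using c0[of j] unfolding holds_coset_fm by (intro exI[of _ w]) (simp add: field_simps)
    moreover have "(coset_fm q 1, [c i]) \<in> formulas_over (A \<union> c ` {..<j}) 1"
      using that by (intro coset_fm_formulas_over) simp
    ultimately have "generic_set {y. holds R (coset_fm q 1, [c i]) [y]}"
      using c[of j] unfolding generic_over_def by blast
    then show False using coset_not_generic[OF assms(3,4) c0[of i]] by (simp add: holds_coset_fm)
  qed
  show ?thesis
    unfolding divides_def
  proof (intro exI[of _ 2] exI[of _ "\<lambda>i. [c i]"] conjI allI impI)
    show "length [c i] = length (snd (coset_fm q f, [b]))" for i by simp
    show "tp R [c i] A = tp R (snd (coset_fm q f, [b])) A" for i
      using tp_generic_over[OF cA] tp_generic_over[OF assms(2)] by simp
    fix I :: "nat set" assume "finite I \<and> card I = 2"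
    then obtain i j where ij: "I = {i, j}" "i < j"
      by (metis card_2_iff insert_commute linorder_neqE_nat)
    show "\<not> (\<exists>a. length a = 1 \<and> (\<forall>i\<in>I. holds R (fst (coset_fm q f, [b]), [c i]) a))"
    proof
      assume "\<exists>a. length a = 1 \<and> (\<forall>i\<in>I. holds R (fst (coset_fm q f, [b]), [c i]) a)"
      then obtain a where a: "length a = 1" "\<forall>i\<in>I. holds R (coset_fm q f, [c i]) a" by auto
      then obtain x where "a = [x]" by (cases a) auto
      then show False using a(2) ij no_common[of i j x] by (simp add: holds_coset_fm)
    qed
  qed
qed

text \<open>The weight is witnessed with \<open>B = A\<close> by the monomial \<open>a\<close> and
  the independent generics \<open>b i\<close>; dependence on \<open>b i\<close> shows in the coset
  of \<open>a\<close> modulo \<open>q i\<close>-th powers.\<close>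

lemma card_primes_le_weight:
  assumes "small \<kappa> A" "generic_type R A p"
    and "finite F" "F \<subseteq> {q. prime q \<and> {x ^ q | x :: 'k. True} \<noteq> UNIV}"
  shows "enat (card F) \<le> weight \<kappa> R A p"
\<comment> \<open>Without primes the monomial would be the empty product 1, which is not
  generic.\<close>
proof (cases "card F = 0")
  case True
  then show ?thesis by (simp flip: zero_enat_def)
next
  case False
  define n where "n = card F"
  obtain q where "bij_betw q {0..<n} F" using ex_bij_betw_nat_finite[OF assms(3)] unfolding n_def by blast
  then have q: "inj_on q {..<n}" "q ` {..<n} = F" by (auto simp: bij_betw_def atLeast0LessThan)
  have prime: "prime (q i)" and not_UNIV: "{x ^ q i | x :: 'k. True} \<noteq> UNIV" if "i < n" for i
    using q(2) assms(4) that by auto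
  have coprime: "coprime (q i) (q j)" if "i < n" "j < n" "i \<noteq> j" for i j
    using that prime q(1) by (auto intro!: primes_coprime simp: inj_on_def)
  have q0: "0 < q i" if "i < n" for i using prime[OF that] prime_gt_0_nat by blast
  define f where "f i = (\<Prod>k\<in>{..<n} - {i}. q k)" for i
  obtain b where b: "\<And>i::nat. generic_over R (A \<union> b ` {..<i}) (b i)"
    using ex_generic_sequence_simple[OF assms(1)] by blast
  have b0: "b i \<noteq> 0" for i using b by (rule generic_over_nonzero)
  define a where "a = (\<Prod>i<n. b i ^ f i)"
  have a: "generic_over R A a"
    unfolding a_def
  proof (rule generic_over_prod_powers[OF assms(1) b])
    show "\<exists>s. (\<forall>i. s i \<noteq> 0) \<and> (\<Prod>i<n. s i ^ f i) = t" if "t \<noteq> 0" for t :: 'k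
      unfolding f_def by (rule ex_prod_powers) (use that False coprime q0 in \<open>auto simp: n_def\<close>)
  qed
  have dep: "\<not> indep R [a] A (set [b i])" if i: "i < n" for i
  proof -
    let ?\<psi> = "(coset_fm (q i) (f i), [b i])"
    have "divides R 1 A ?\<psi>"
    proof (rule coset_fm_divides[OF assms(1) _ not_UNIV[OF i] q0[OF i]])
      show "generic_over R A (b i)" using b by (rule generic_over_mono) simp
      show "coprime (f i) (q i)" unfolding f_def using i coprime by (intro prod_coprime_left) auto
      show "f i \<noteq> 0" unfolding f_def using q0 by fastforce
    qed
    moreover have "?\<psi> \<in> formulas_over UNIV 1" by (rule coset_fm_formulas_over) simp
    moreover have "?\<psi> \<in> tp R [a] (A \<union> set [b i])"
    proof -
      \<comment> \<open>For \<open>j \<noteq> i\<close> the exponent \<open>f j\<close> contains the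
        factor \<open>q i\<close>, so all factors of \<open>a\<close> except the one from
        \<open>b i\<close> multiply to a \<open>q i\<close>-th power.\<close>
      have "f j = q i * (\<Prod>k\<in>{..<n} - {j} - {i}. q k)" if "j < n" "j \<noteq> i" for j
        unfolding f_def using i that by (subst prod.remove[of _ i]) auto
      then have "(\<Prod>j\<in>{..<n} - {i}. b j ^ f j) = (\<Prod>j\<in>{..<n} - {i}. b j ^ (\<Prod>k\<in>{..<n} - {j} - {i}. q k)) ^ q i"
        unfolding prod_power_distrib by (intro prod.cong) (auto simp: power_mult[symmetric] mult.commute)
      then obtain z where z: "(\<Prod>j\<in>{..<n} - {i}. b j ^ f j) = z ^ q i" by blast
      have "a = b i ^ f i * z ^ q i" unfolding a_def z[symmetric] using i by (intro prod.remove) auto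
      moreover have "z ^ q i \<noteq> 0" unfolding z[symmetric] using b0 by simp
      ultimately have "a * (1 / z) ^ q i = b i ^ f i" by (simp add: power_divide)
      then have "holds R ?\<psi> [a]" unfolding holds_coset_fm by blast
      moreover have "?\<psi> \<in> formulas_over (A \<union> set [b i]) 1" by (rule coset_fm_formulas_over) simp
      ultimately show ?thesis unfolding tp_def by simp
    qed
    \<comment> \<open>The singleton of \<open>?\<psi>\<close> serves both as the set of dividing
      formulas and as the part of the type that implies their disjunction.\<close>
    ultimately show ?thesis
      unfolding indep_def forks_def
      by (auto intro!: exI[of _ "{?\<psi>}"])
  qed
  have "tp R [a] A = p" using tp_generic_over[OF a] generic_type_eq[OF assms(2)] by simp
  moreover have "\<not> forks R (length [a]) A (tp R [a] A)" using generic_over_not_forks[OF a] by simp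
  moreover have "indep_seq R A (enat n) (\<lambda>i. [b i])"
    unfolding indep_seq_def
  proof (intro allI impI)
    fix i
    have "(\<Union>j<i. set [b j]) = b ` {..<i}" by auto
    then show "indep R [b i] A (\<Union>j<i. set [b j])"
      unfolding indep_def using generic_over_not_forks[OF b] by simp
  qed
  ultimately show ?thesis
    unfolding weight_def n_def[symmetric] using dep assms(1)
    by (intro Sup_upper CollectI exI[of _ "[a]"] exI[of _ A] exI[of _ "\<lambda>i. [b i]"]) simp
qed

end

theorem corollary3p2:
  fixes R :: "'r \<Rightarrow> 'k::field list \<Rightarrow> bool"
    and \<kappa> :: "'i rel"
    and A :: "'k set"
    and p :: "('r, 'k) pfm set"
    and w :: nat
  assumes "infinite (UNIV :: 'k set)"
    and "monster \<kappa> R"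
    and "stable_theory R"
    and "small \<kappa> A"
    and "generic_type R A p"
    and "weight \<kappa> R A p = enat w"
  shows "finite {q :: nat. prime q \<and> {x ^ q | x :: 'k. True} \<noteq> UNIV} \<and>
         card {q :: nat. prime q \<and> {x ^ q | x :: 'k. True} \<noteq> UNIV} \<le> w"
proof -
  interpret stable_monster_field \<kappa> R using assms(1-3) by unfold_locales
  define S where "S = {q :: nat. prime q \<and> {x ^ q | x :: 'k. True} \<noteq> UNIV}"
  have le: "card F \<le> w" if "finite F" "F \<subseteq> S" for F
    using card_primes_le_weight[OF assms(4,5) that[unfolded S_def]] assms(6) by simp
  have "finite S"
  proof (rule ccontr)
    assume "infinite S"
    then obtain F where "finite F" "card F = Suc w" "F \<subseteq> S" using infinite_arbitrarily_large by blast
    then show False using le[of F] by simp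
  qed
  then show ?thesis using le[of S] unfolding S_def by simp
qed

end
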